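(* Let $d\ge 1$, let $A,B$ be finite alphabets, let $p$ be a probability vector on $A$ and $q$ a probability vector on $B$, and let $X\sim\mu=p^{\mathbb{Z}^d}$ and $Y\sim\nu=q^{\mathbb{Z}^d}$ be the corresponding i.i.d. $\mathbb{Z}^d$-processes. Assume $X$ and $Y$ have equal entropy, $h(p)=h(q)$. If there exists a finitary homomorphism $\phi:X\to Y$ whose coding radius satisfies $\mathbf{E}[R_\phi^{d/2}]<\infty$, then $\mathrm{Var}(I_p(X_0))=\mathrm{Var}(I_q(Y_0))$, i.e. $\mathrm{Var}(\log p(X_0))=\mathrm{Var}(\log q(Y_0))$.
   Context: For a finite probability vector $p$ on $A$, the entropy is $h(p)=-\sum_{a\in A}p_a\log p_a$ and the information function is $I_p(a)=\log p_a^{-1}$. A homomorphism (factor map) $\phi:X\to Y$ is a measurable map $\phi:A^{\mathbb{Z}^d}\to B^{\mathbb{Z}^d}$, defined $\mu$-a.e., that commutes with the $\mathbb{Z}^d$-shifts ($\phi(T_{u}x)=T_u\phi(x)$, where $(T_{-u}x)_v=x_{v+u}$) and satisfies $\phi_*\mu=\nu$. With $B(0,n)=[-n,n]^d\subset\mathbb{Z}^d$, the coding radius of $\phi$ is the random variable $R_\phi(x)=\min\{n\in\mathbb{N}\cup\{\infty\}: \text{for }\mu\text{-a.e. } a,\ (a_i)_{i\in B(0,n)}=(x_i)_{i\in B(0,n)}\Rightarrow \phi(a)_0=\phi(x)_0\}$. The map $\phi$ is finitary if $R_\phi<\infty$ $\mu$-a.s. *)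

theory Defs
  imports "HOL-Probability.Probability"
begin

text \<open>Lattice points of Z^d are vectors int^'d with 'd a finite type, d = CARD('d) \<ge> 1.
  Configurations are maps from lattice points to the alphabet.\<close>

definition iid_measure :: "'a pmf \<Rightarrow> (int^'d \<Rightarrow> 'a) measure" where
  "iid_measure p = PiM UNIV (\<lambda>_. measure_pmf p)"

definition entropy_pv :: "'a::finite pmf \<Rightarrow> real" where
  "entropy_pv p = - (\<Sum>a\<in>UNIV. pmf p a * ln (pmf p a))"

definition info_fun :: "'a pmf \<Rightarrow> 'a \<Rightarrow> real" where
  "info_fun p a = ln (1 / pmf p a)"

definition shift :: "int^'d \<Rightarrow> (int^'d \<Rightarrow> 'a) \<Rightarrow> (int^'d \<Rightarrow> 'a)" where
  "shift u x = (\<lambda>v. x (v - u))"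

definition is_homomorphism ::
  "(int^'d \<Rightarrow> 'a) measure \<Rightarrow> (int^'d \<Rightarrow> 'b) measure
     \<Rightarrow> ((int^'d \<Rightarrow> 'a) \<Rightarrow> (int^'d \<Rightarrow> 'b)) \<Rightarrow> bool" where
  "is_homomorphism \<mu> \<nu> \<phi> \<longleftrightarrow>
     \<phi> \<in> measurable \<mu> \<nu> \<and>
     (AE x in \<mu>. \<forall>u. \<phi> (shift u x) = shift u (\<phi> x)) \<and>
     distr \<mu> \<nu> \<phi> = \<nu>"

definition box :: "nat \<Rightarrow> (int^'d) set" where
  "box n = {v. \<forall>i. \<bar>v $ i\<bar> \<le> int n}"

definition coding_radius ::
  "(int^'d \<Rightarrow> 'a) measure \<Rightarrow> ((int^'d \<Rightarrow> 'a) \<Rightarrow> (int^'d \<Rightarrow> 'b))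
     \<Rightarrow> (int^'d \<Rightarrow> 'a) \<Rightarrow> enat" where
  "coding_radius \<mu> \<phi> x =
     (let P = (\<lambda>n::nat. AE a in \<mu>. (\<forall>i\<in>box n. a i = x i) \<longrightarrow> \<phi> a 0 = \<phi> x 0)
      in if \<exists>n. P n then enat (LEAST n. P n) else \<infinity>)"

definition finitary :: "(int^'d \<Rightarrow> 'a) measure \<Rightarrow> ((int^'d \<Rightarrow> 'a) \<Rightarrow> (int^'d \<Rightarrow> 'b)) \<Rightarrow> bool" where
  "finitary \<mu> \<phi> \<longleftrightarrow> (AE x in \<mu>. coding_radius \<mu> \<phi> x < \<infinity>)"

end

theory Submission
  imports Defs
begin

text \<open>
  Write \<open>Y = \<phi> X\<close>. If the pattern of \<open>X\<close> on a finite set \<open>L\<close> determines \<open>Y\<close> on \<open>K\<close>, then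
  \<open>p(X\<^sub>L) \<le> q(Y\<^sub>K)\<close>; hence, almost surely, the information of \<open>Y\<close> on \<open>L\<close> exceeds that of \<open>X\<close>
  on \<open>L\<close> by at most a constant times the number of sites of \<open>L\<close> at which \<open>Y\<close> is not determined
  by \<open>X\<^sub>L\<close>. For \<open>d \<ge> 2\<close> the boundary alone spoils this bound on the scale \<open>|L|\<^bsup>1/2\<^esup>\<close> of the central
  limit theorem. Being pointwise, however, the inequality may be integrated against any
  density. Tile space by cubes of side \<open>l\<close>, each containing a concentric smaller cube, and use the
  density \<open>\<Prod>\<^sub>i (1 + \<psi>\<^sub>i)\<close> with \<open>\<psi>\<^sub>i\<close> a centred function, bounded by 1, of \<open>X\<close> on the \<open>i\<close>-th smaller
  cube. Letting the number of tiles tend to infinity removes the boundary term, and within each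
  tile only its own factor is felt. Thus, if \<open>D\<close> denotes the difference of the informations of \<open>Y\<close>
  and \<open>X\<close> on a tile \<open>K\<close>, then \<open>E[\<psi> D]\<close> is at most a constant times \<open>|K| P(R > n)\<close>. Taking for \<open>\<psi>\<close> the
  centred sign of a local version of \<open>D\<close> bounds \<open>E|D|\<close>; since the moment hypothesis gives
  \<open>P(R > n) = o(n\<^bsup>-d/2\<^esup>)\<close>, it follows that \<open>E|D| = o(|K|\<^bsup>1/2\<^esup>)\<close> for \<open>l\<close> a large multiple of \<open>n\<close>. Fourth
  moments upgrade this to \<open>E D\<^sup>2 = o(|K|)\<close>, which forces the two variances to agree.
\<close>

subsection \<open>Functions of finitely many coordinates\<close>

text \<open>A pointwise notion, without null sets or sigma-algebras. For a finite \<open>A\<close>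
  and a finite alphabet such functions have finite range, so measurability and integrability need no
  separate argument.\<close>

definition depends_on :: "'i set \<Rightarrow> (('i \<Rightarrow> 'a) \<Rightarrow> 'c) \<Rightarrow> bool" where
  "depends_on A F \<longleftrightarrow> (\<forall>x y. (\<forall>i\<in>A. x i = y i) \<longrightarrow> F x = F y)"

lemma depends_onI: "(\<And>x y. (\<And>i. i \<in> A \<Longrightarrow> x i = y i) \<Longrightarrow> F x = F y) \<Longrightarrow> depends_on A F"
  unfolding depends_on_def by blast

lemma depends_onD: "depends_on A F \<Longrightarrow> (\<And>i. i \<in> A \<Longrightarrow> x i = y i) \<Longrightarrow> F x = F y"
  unfolding depends_on_def by blast

lemma depends_on_mono: "depends_on A F \<Longrightarrow> A \<subseteq> B \<Longrightarrow> depends_on B F"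
  unfolding depends_on_def by blast

lemma depends_on_comp: "depends_on A F \<Longrightarrow> depends_on A (\<lambda>x. g (F x))"
  unfolding depends_on_def by fastforce

lemma depends_on_comp2: "depends_on A F \<Longrightarrow> depends_on A G \<Longrightarrow> depends_on A (\<lambda>x. g (F x) (G x))"
  unfolding depends_on_def by fastforce

lemma depends_on_sum:
  "(\<And>v. v \<in> S \<Longrightarrow> depends_on A (F v)) \<Longrightarrow> depends_on A (\<lambda>x. \<Sum>v\<in>S. F v x)"
  unfolding depends_on_def by (intro allI impI sum.cong refl) blast

lemma depends_on_prod:
  "(\<And>v. v \<in> S \<Longrightarrow> depends_on A (F v)) \<Longrightarrow> depends_on A (\<lambda>x. \<Prod>v\<in>S. F v x)"
  unfolding depends_on_def by (intro allI impI prod.cong refl) blast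

lemma depends_on_restrict: "depends_on A F \<Longrightarrow> F (restrict x A) = F x"
  unfolding depends_on_def by simp

lemma depends_on_shift:
  fixes F :: "(int^'d \<Rightarrow> 'a) \<Rightarrow> 'c"
  assumes "depends_on A F" "\<And>w. w \<in> A \<Longrightarrow> w + v \<in> B"
  shows "depends_on B (\<lambda>x. F (shift (- v) x))"
  using assms unfolding depends_on_def shift_def by simp

lemma finite_range_depends_on:
  fixes F :: "('i \<Rightarrow> 'a::finite) \<Rightarrow> 'c"
  assumes "finite A" "depends_on A F"
  shows "finite (range F)"
proof -
  have "range F \<subseteq> F ` (PiE A (\<lambda>_. UNIV))"
  proof
    fix y assume "y \<in> range F"
    then obtain x where "y = F (restrict x A)"
      using depends_on_restrict[OF assms(2)] by (metis rangeE)
    then show "y \<in> F ` (PiE A (\<lambda>_. UNIV))" by auto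
  qed
  moreover have "finite (F ` (PiE A (\<lambda>_. UNIV)))"
    using assms(1) by (intro finite_imageI finite_PiE) auto
  ultimately show ?thesis
    by (rule finite_subset)
qed

lemma bounded_depends_on:
  fixes F :: "('i \<Rightarrow> 'a::finite) \<Rightarrow> real"
  assumes "finite A" "depends_on A F"
  obtains B where "\<And>x. \<bar>F x\<bar> \<le> B"
proof -
  have "finite (range (\<lambda>x. \<bar>F x\<bar>))"
    using finite_range_depends_on[OF assms(1) depends_on_comp[OF assms(2)]] .
  then show ?thesis
    by (intro that[of "Max (range (\<lambda>x. \<bar>F x\<bar>))"]) auto
qed

section \<open>The i.i.d. measure: measurability, independence, shift invariance\<close>

lemma space_iid [simp]: "space (iid_measure p) = UNIV"
  by (auto simp: iid_measure_def space_PiM)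

lemma prob_space_iid: "prob_space (iid_measure p)"
  unfolding iid_measure_def by (intro prob_space_PiM prob_space_measure_pmf)

lemma measurable_coord_iid [measurable]:
  "(\<lambda>x. x v) \<in> measurable (iid_measure p) (count_space UNIV)"
proof -
  have "(\<lambda>x. x v) \<in> measurable (iid_measure p) (measure_pmf p)"
    unfolding iid_measure_def by (rule measurable_component_singleton) auto
  then show ?thesis
    by (simp cong: measurable_cong_sets)
qed

lemma measurable_from_coord_iid [measurable]:
  "(\<lambda>x. f (x v) :: real) \<in> borel_measurable (iid_measure p)"
  by (rule measurable_compose[OF measurable_coord_iid]) auto

text \<open>The set is the union of the cylinders over those patterns on \<open>A\<close> that
  satisfy \<open>P\<close>, and there are only finitely many patterns.\<close>

lemma sets_depends_on:
  fixes p :: "'a::finite pmf" and P :: "(int^'d \<Rightarrow> 'a) \<Rightarrow> bool"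
  assumes "finite A" "depends_on A P"
  shows "{x. P x} \<in> sets (iid_measure p)"
proof -
  let ?W = "{w\<in>PiE A (\<lambda>_. UNIV). P w}"
  have eq: "{x. P x} = (\<Union>w\<in>?W. {x. \<forall>i\<in>A. x i = w i})"
  proof (intro set_eqI iffI)
    fix x assume "x \<in> {x. P x}"
    then show "x \<in> (\<Union>w\<in>?W. {x. \<forall>i\<in>A. x i = w i})"
      using depends_on_restrict[OF assms(2), of x] by (auto intro!: exI[of _ "restrict x A"])
  next
    fix x assume "x \<in> (\<Union>w\<in>?W. {x. \<forall>i\<in>A. x i = w i})"
    then show "x \<in> {x. P x}" using depends_onD[OF assms(2)] by blast
  qed
  have "{x. \<forall>i\<in>A. x i = w i} \<in> sets (iid_measure p)" for w
  proof -
    have "{x\<in>space (iid_measure p). \<forall>i\<in>A. x i = w i} \<in> sets (iid_measure p)"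
      using assms(1) by measurable
    then show ?thesis by simp
  qed
  moreover have "finite ?W"
    using finite_PiE[OF assms(1), of "\<lambda>_. UNIV :: 'a set"] by (rule rev_finite_subset) auto
  ultimately show ?thesis
    by (subst eq, intro sets.finite_UN) auto
qed

lemma measurable_depends_on:
  fixes p :: "'a::finite pmf" and F :: "(int^'d \<Rightarrow> 'a) \<Rightarrow> real"
  assumes "finite A" "depends_on A F"
  shows "F \<in> borel_measurable (iid_measure p)"
proof (rule measurableI)
  fix S :: "real set"
  have "F -` S \<inter> space (iid_measure p) = {x. F x \<in> S}" by auto
  then show "F -` S \<inter> space (iid_measure p) \<in> sets (iid_measure p)"
    using sets_depends_on[OF assms(1) depends_on_comp[OF assms(2), of "\<lambda>y. y \<in> S"]] by simp
qed auto

lemma integrable_depends_on: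
  fixes p :: "'a::finite pmf" and F :: "(int^'d \<Rightarrow> 'a) \<Rightarrow> real"
  assumes "finite A" "depends_on A F"
  shows "integrable (iid_measure p) F"
proof -
  interpret prob_space "iid_measure p :: (int^'d \<Rightarrow> 'a) measure" by (rule prob_space_iid)
  obtain B where "\<And>x. \<bar>F x\<bar> \<le> B" by (rule bounded_depends_on[OF assms]) blast
  then show ?thesis
    using measurable_depends_on[OF assms] by (intro integrable_const_bound[of _ B]) auto
qed

lemma measurable_coord_pmf: "(\<lambda>x. x v) \<in> measurable (iid_measure p) (measure_pmf p)"
  unfolding iid_measure_def by (rule measurable_component_singleton) auto

lemma distr_coord_iid: "distr (iid_measure p) (measure_pmf p) (\<lambda>x. x v) = measure_pmf p"
  unfolding iid_measure_def by (rule distr_PiM_component) (auto intro: prob_space_measure_pmf)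

lemma indep_coords_iid:
  "prob_space.indep_vars (iid_measure p :: (int^'d \<Rightarrow> 'a) measure) (\<lambda>_. measure_pmf p) (\<lambda>v x. x v) UNIV"
proof -
  interpret prob_space "iid_measure p :: (int^'d \<Rightarrow> 'a) measure" by (rule prob_space_iid)
  have "distr (iid_measure p) (PiM UNIV (\<lambda>_. measure_pmf p)) (\<lambda>x. \<lambda>v\<in>UNIV. x v)
    = PiM UNIV (\<lambda>v::int^'d. distr (iid_measure p) (measure_pmf p) (\<lambda>x. x v))"
    by (simp only: distr_coord_iid restrict_UNIV) (simp add: iid_measure_def distr_id2)
  then show ?thesis
    by (subst indep_vars_iff_distr_eq_PiM') (auto intro: measurable_coord_pmf)
qed

lemma iid_integral_mult:
  fixes p :: "'a::finite pmf" and F G :: "(int^'d \<Rightarrow> 'a) \<Rightarrow> real"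
  assumes "finite A" "finite B" "A \<inter> B = {}" "depends_on A F" "depends_on B G"
  shows "(\<integral>x. F x * G x \<partial>iid_measure p) = (\<integral>x. F x \<partial>iid_measure p) * (\<integral>x. G x \<partial>iid_measure p)"
proof -
  interpret prob_space "iid_measure p :: (int^'d \<Rightarrow> 'a) measure" by (rule prob_space_iid)
  let ?P = "\<lambda>A. PiM A (\<lambda>_::int^'d. measure_pmf p)"
  \<comment> \<open>A finite product of discrete spaces over a finite alphabet is again discrete, so
    every real function on it is measurable.\<close>
  have meas: "H \<in> borel_measurable (?P C)" if "finite C" for H :: "_ \<Rightarrow> real" and C
  proof -
    have "sets (?P C) = sets (count_space (PiE C (\<lambda>_. UNIV)))"
      using that by (subst count_space_PiM_finite[symmetric]) (auto intro!: sets_PiM_cong)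
    then show ?thesis
      by (subst measurable_cong_sets[of _ "count_space (PiE C (\<lambda>_. UNIV))", OF _ refl]) auto
  qed
  have "indep_var (?P A) (\<lambda>x. restrict (\<lambda>i. x i) A) (?P B) (\<lambda>x. restrict (\<lambda>i. x i) B)"
    using assms(3) by (intro indep_var_restrict[OF indep_coords_iid]) auto
  from indep_var_compose[OF this meas[OF assms(1), of F] meas[OF assms(2), of G]]
  have "indep_var borel F borel G"
    using depends_on_restrict[OF assms(4)] depends_on_restrict[OF assms(5)]
    by (simp add: comp_def)
  then show ?thesis
    using assms by (intro indep_var_lebesgue_integral integrable_depends_on[of A F] integrable_depends_on[of B G])
qed

lemma distr_shift_iid: "distr (iid_measure p) (iid_measure p) (shift u) = iid_measure p"
proof -
  have "distr (iid_measure p) (iid_measure p) (\<lambda>x. \<lambda>v\<in>UNIV. x (v - u)) = iid_measure p"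
    unfolding iid_measure_def
    by (rule distr_PiM_reindex[where f = "\<lambda>v. v - u"])
       (auto simp: inj_on_def intro: prob_space_measure_pmf)
  then show ?thesis by (simp add: shift_def[abs_def] restrict_UNIV)
qed

lemma measurable_shift_iid [measurable]:
  "shift u \<in> measurable (iid_measure p) (iid_measure p)"
  unfolding shift_def[abs_def] iid_measure_def
  by (rule measurable_PiM_single') (auto simp: space_PiM intro!: measurable_component_singleton simp del: measurable_pmf_measure2)

lemma integral_shift_iid:
  fixes F :: "_ \<Rightarrow> real"
  assumes "F \<in> borel_measurable (iid_measure p)"
  shows "(\<integral>x. F (shift u x) \<partial>iid_measure p) = (\<integral>x. F x \<partial>iid_measure p)"
  using integral_distr[OF measurable_shift_iid[of u p] assms] by (simp add: distr_shift_iid)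

lemma AE_shift_iid:
  assumes "AE x in iid_measure p. P x"
  shows "AE x in iid_measure p. P (shift u x)"
  by (rule AE_distrD[OF measurable_shift_iid[of u p]]) (unfold distr_shift_iid, rule assms)

lemma measure_cylinder_iid:
  assumes "finite J"
  shows "measure (iid_measure p) {x. \<forall>v\<in>J. x v = w v} = (\<Prod>v\<in>J. pmf p (w v))"
proof -
  interpret product_prob_space "\<lambda>_. measure_pmf p" UNIV ..
  have eq: "{x. \<forall>v\<in>J. x v = w v} = prod_emb UNIV (\<lambda>_. measure_pmf p) J (PiE J (\<lambda>v. {w v}))"
    by (auto simp: prod_emb_def PiE_iff restrict_def extensional_def)
  show ?thesis
    unfolding iid_measure_def eq using assms
    by (subst measure_PiM_emb) (auto simp: measure_pmf_single)
qed

lemma integral_coord_iid: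
  fixes p :: "'a::finite pmf" and f :: "'a \<Rightarrow> real"
  shows "(\<integral>x. f (x v) \<partial>iid_measure p) = (\<Sum>a\<in>UNIV. pmf p a * f a)"
proof -
  have "(\<integral>x. f (x v) \<partial>iid_measure p) = (\<integral>a. f a \<partial>distr (iid_measure p) (measure_pmf p) (\<lambda>x. x v))"
    by (subst integral_distr[OF measurable_coord_pmf]) auto
  also have "\<dots> = (\<integral>a. f a \<partial>measure_pmf p)"
    by (simp only: distr_coord_iid)
  finally show ?thesis
    by (simp add: integral_measure_pmf_real[of UNIV] mult.commute)
qed

text \<open>Factors of mean 1 whose supports avoid \<open>E\<close> and each other are split off one
  at a time by independence. Applied to a product density, this shows that a local function feels
  only the factors meeting its support.\<close>

lemma integral_mult_prod_indep:
  fixes p :: "'a::finite pmf" and F :: "(int^'d \<Rightarrow> 'a) \<Rightarrow> real"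
  assumes "finite J" "finite E" "\<And>j. j \<in> J \<Longrightarrow> finite (B j)" "disjoint_family_on B J"
    and "\<And>j. j \<in> J \<Longrightarrow> E \<inter> B j = {}"
    and "depends_on E F" "\<And>j. j \<in> J \<Longrightarrow> depends_on (B j) (g j)"
    and "\<And>j. j \<in> J \<Longrightarrow> (\<integral>x. g j x \<partial>iid_measure p) = 1"
  shows "(\<integral>x. F x * (\<Prod>j\<in>J. g j x) \<partial>iid_measure p) = (\<integral>x. F x \<partial>iid_measure p)"
  using assms
proof (induction J rule: finite_induct)
  case empty
  then show ?case by simp
next
  case (insert j J)
  let ?A = "E \<union> (\<Union>k\<in>J. B k)"
  have IH: "(\<integral>x. F x * (\<Prod>j\<in>J. g j x) \<partial>iid_measure p) = (\<integral>x. F x \<partial>iid_measure p)"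
    using insert.prems by (intro insert.IH) (auto simp: disjoint_family_on_def)
  have "B k \<inter> B j = {}" if "k \<in> J" for k
    using insert.prems(3) insert.hyps(2) that by (auto simp: disjoint_family_on_def)
  then have disj: "?A \<inter> B j = {}"
    using insert.prems(4)[of j] by auto
  have "depends_on ?A (\<lambda>x. F x * (\<Prod>j\<in>J. g j x))"
  proof (intro depends_on_comp2[where g = "(*)"] depends_on_prod)
    show "depends_on ?A F" by (rule depends_on_mono[OF insert.prems(5)]) auto
    show "depends_on ?A (g k)" if "k \<in> J" for k
      using that by (intro depends_on_mono[OF insert.prems(6)[of k]]) auto
  qed
  then have "(\<integral>x. (F x * (\<Prod>j\<in>J. g j x)) * g j x \<partial>iid_measure p)
      = (\<integral>x. F x * (\<Prod>j\<in>J. g j x) \<partial>iid_measure p) * (\<integral>x. g j x \<partial>iid_measure p)"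
    using insert.hyps insert.prems(1,2) disj
    by (intro iid_integral_mult[of ?A "B j"] insert.prems) auto
  then show ?case
    using insert.hyps by (simp add: IH insert.prems mult_ac)
qed

subsection \<open>Moments and cubes\<close>

text \<open>Induction on \<open>B\<close>, splitting off one coordinate. In the expanded powers
  every term with a centred factor to the first power vanishes, so second moments add up, and the
  fourth moment grows by at most \<open>c^4 + 6 * c^4 * card B\<close>.\<close>

lemma iid_sum_moments:
  fixes p :: "'a::finite pmf" and f :: "'a \<Rightarrow> real" and B :: "(int^'d) set"
  assumes "finite B" and mean: "(\<Sum>a\<in>UNIV. pmf p a * f a) = 0" and c: "\<And>a. \<bar>f a\<bar> \<le> c"
  defines "S \<equiv> \<lambda>B x. \<Sum>v\<in>B. f (x v)"
  shows "(\<integral>x. S B x \<partial>iid_measure p) = 0"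
    and "(\<integral>x. (S B x)^2 \<partial>iid_measure p) = real (card B) * (\<Sum>a\<in>UNIV. pmf p a * (f a)^2)"
    and "(\<integral>x. (S B x)^4 \<partial>iid_measure p) \<le> 3 * c^4 * (real (card B))^2"
proof -
  interpret prob_space "iid_measure p :: (int^'d \<Rightarrow> 'a) measure" by (rule prob_space_iid)
  let ?s2 = "\<Sum>a\<in>UNIV. pmf p a * (f a)^2"
  have avg: "(\<Sum>a\<in>UNIV. pmf p a * g a) \<le> K" if "\<And>a. g a \<le> K" for g K
  proof -
    have "(\<Sum>a\<in>UNIV. pmf p a * g a) \<le> (\<Sum>a\<in>UNIV. pmf p a * K)"
      using that by (intro sum_mono mult_left_mono) auto
    also have "\<dots> = K"
      by (simp add: sum_distrib_right[symmetric] sum_pmf_eq_1)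
    finally show ?thesis .
  qed
  have "\<bar>f a\<bar>^k \<le> c^k" for a and k :: nat using c by (intro power_mono) auto
  from this[of _ 2] this[of _ 4] have p24: "(f a)^2 \<le> c^2" "(f a)^4 \<le> c^4" for a by simp_all
  have s2: "?s2 \<le> c^2" and s4: "(\<Sum>a\<in>UNIV. pmf p a * (f a)^4) \<le> c^4"
    using p24 by (auto intro!: avg)
  have depS: "depends_on B (\<lambda>x. S B x ^ k)" for B :: "(int^'d) set" and k
    unfolding S_def by (rule depends_onI) (simp cong: sum.cong)
  have depX: "depends_on {v} (\<lambda>x. f (x v) ^ k)" for v :: "int^'d" and k
    by (rule depends_onI) simp
  have "expectation (S B) = 0 \<and> expectation (\<lambda>x. (S B x)^2) = real (card B) * ?s2 \<and>
    expectation (\<lambda>x. (S B x)^4) \<le> 3 * c^4 * (real (card B))^2"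
    using assms(1)
  proof (induction B rule: finite_induct)
    case empty
    then show ?case by (simp add: S_def)
  next
    case (insert v B)
    have mix: "expectation (\<lambda>x. f (x v) ^ i * S B x ^ j)
        = (\<Sum>a\<in>UNIV. pmf p a * f a ^ i) * expectation (\<lambda>x. S B x ^ j)" for i j
    proof -
      have "expectation (\<lambda>x. f (x v) ^ i * S B x ^ j)
          = expectation (\<lambda>x. f (x v) ^ i) * expectation (\<lambda>x. S B x ^ j)"
        using insert(1,2) by (intro iid_integral_mult[of "{v}" B] depX depS) auto
      then show ?thesis
        by (simp only: integral_coord_iid[where f = "\<lambda>a. f a ^ i"])
    qed
    have int: "integrable (iid_measure p) (\<lambda>x. f (x v) ^ i * S B x ^ j)" for i j
    proof (rule integrable_depends_on[of "insert v B"])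
      show "depends_on (insert v B) (\<lambda>x. f (x v) ^ i * S B x ^ j)"
        by (intro depends_on_comp2[where g = "(*)"] depends_on_mono[OF depX, of v "insert v B" i]
          depends_on_mono[OF depS, of B "insert v B" j]) auto
    qed (use insert(1) in auto)
    have ins: "S (insert v B) x = f (x v) + S B x" for x
      using insert(1,2) by (simp add: S_def)
    \<comment> \<open>The exponents 0 and 1 are kept, so that every term has the form
      \<open>f (x v) ^ i * S B x ^ j\<close> to which \<open>int\<close> and the variants of
      \<open>mix\<close> apply.\<close>
    have e2: "S (insert v B) x ^ 2 = f (x v)^2 * S B x^0 + (2 * (f (x v)^1 * S B x^1) + f (x v)^0 * S B x^2)" for x
      unfolding ins by (simp add: power2_sum)
    have e4: "S (insert v B) x ^ 4 = f (x v)^4 * S B x^0 + (4 * (f (x v)^3 * S B x^1)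
      + (6 * (f (x v)^2 * S B x^2) + (4 * (f (x v)^1 * S B x^3) + f (x v)^0 * S B x^4)))" for x
      unfolding ins by (simp add: power4_eq_xxxx power3_eq_cube power2_eq_square algebra_simps)
    have e1: "S (insert v B) x = f (x v)^1 * S B x^0 + f (x v)^0 * S B x^1" for x
      by (simp add: ins)
    have pm: "(\<Sum>a\<in>UNIV. pmf p a) = 1" by (simp add: sum_pmf_eq_1)
    have mix0: "expectation (\<lambda>x. f (x v) ^ 0 * S B x ^ j) = expectation (\<lambda>x. S B x ^ j)" for j
      using mix[of 0 j] by (simp add: pm)
    have mix1: "expectation (\<lambda>x. f (x v) ^ 1 * S B x ^ j) = 0" for j
      using mix[of 1 j] by (simp add: mean)
    have mixS: "expectation (\<lambda>x. f (x v) ^ i * S B x ^ 1) = 0" for i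
      using mix[of i 1] insert.IH by simp
    have mixX: "expectation (\<lambda>x. f (x v) ^ i * S B x ^ 0) = (\<Sum>a\<in>UNIV. pmf p a * f a ^ i)" for i
      using mix[of i 0] prob_space by simp
    have 1: "expectation (S (insert v B)) = 0"
    proof -
      have "expectation (S (insert v B)) = expectation (\<lambda>x. f (x v)^1 * S B x^0 + f (x v)^0 * S B x^1)"
        by (rule Bochner_Integration.integral_cong[OF refl e1])
      also have "\<dots> = expectation (\<lambda>x. f (x v)^1 * S B x^0) + expectation (\<lambda>x. f (x v)^0 * S B x^1)"
        by (intro Bochner_Integration.integral_add int)
      also have "\<dots> = 0"
        by (simp only: mix1 mixS add_0)
      finally show ?thesis .
    qed
    have 2: "expectation (\<lambda>x. S (insert v B) x ^ 2) = ?s2 + expectation (\<lambda>x. S B x ^ 2)"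
    proof -
      have "expectation (\<lambda>x. S (insert v B) x ^ 2) = expectation (\<lambda>x. f (x v)^2 * S B x^0
          + (2 * (f (x v)^1 * S B x^1) + f (x v)^0 * S B x^2))"
        by (rule Bochner_Integration.integral_cong[OF refl e2])
      also have "\<dots> = expectation (\<lambda>x. f (x v)^2 * S B x^0)
          + (2 * expectation (\<lambda>x. f (x v)^1 * S B x^1) + expectation (\<lambda>x. f (x v)^0 * S B x^2))"
        by (simp only: Bochner_Integration.integral_add Bochner_Integration.integrable_add
          Bochner_Integration.integrable_mult_right int Bochner_Integration.integral_mult_right_zero)
      also have "\<dots> = ?s2 + expectation (\<lambda>x. S B x ^ 2)"
        unfolding mix1 mixX mix0 by simp
      finally show ?thesis .
    qed
    have 4: "expectation (\<lambda>x. S (insert v B) x ^ 4)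
        = (\<Sum>a\<in>UNIV. pmf p a * f a ^ 4) + 6 * (?s2 * expectation (\<lambda>x. S B x ^ 2)) + expectation (\<lambda>x. S B x ^ 4)"
    proof -
      have "expectation (\<lambda>x. S (insert v B) x ^ 4) = expectation (\<lambda>x. f (x v)^4 * S B x^0
          + (4 * (f (x v)^3 * S B x^1)
          + (6 * (f (x v)^2 * S B x^2) + (4 * (f (x v)^1 * S B x^3) + f (x v)^0 * S B x^4))))"
        by (rule Bochner_Integration.integral_cong[OF refl e4])
      also have "\<dots> = expectation (\<lambda>x. f (x v)^4 * S B x^0) + (4 * expectation (\<lambda>x. f (x v)^3 * S B x^1)
          + (6 * expectation (\<lambda>x. f (x v)^2 * S B x^2) + (4 * expectation (\<lambda>x. f (x v)^1 * S B x^3)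
          + expectation (\<lambda>x. f (x v)^0 * S B x^4))))"
        by (simp only: Bochner_Integration.integral_add Bochner_Integration.integrable_add
          Bochner_Integration.integrable_mult_right int Bochner_Integration.integral_mult_right_zero)
      also have "\<dots> = (\<Sum>a\<in>UNIV. pmf p a * f a ^ 4) + 6 * (?s2 * expectation (\<lambda>x. S B x ^ 2))
          + expectation (\<lambda>x. S B x ^ 4)"
        unfolding mix1 mixS mixX mix0 mix[of 2 2] by simp
      finally show ?thesis .
    qed
    have "?s2 * (real (card B) * ?s2) \<le> c^2 * (real (card B) * c^2)"
      using s2 by (intro mult_mono) (auto intro!: sum_nonneg mult_nonneg_nonneg)
    also have "\<dots> = c^4 * real (card B)"
      by (simp add: power4_eq_xxxx power2_eq_square)
    finally have "expectation (\<lambda>x. S (insert v B) x ^ 4)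
        \<le> c^4 + 6 * (c^4 * real (card B)) + 3 * c^4 * (real (card B))^2"
      unfolding 4 using insert.IH s4 by auto
    \<comment> \<open>With \<open>N = card B\<close> this is
      \<open>1 + 6 * N + 3 * N^2 \<le> 3 * (N + 1)^2\<close>; the constant 3 makes the induction
      close.\<close>
    also have "\<dots> \<le> 3 * c^4 * (real (card (insert v B)))^2"
      using insert(1,2) by (simp add: power2_eq_square algebra_simps)
    finally show ?case
      using 1 2 insert by (simp add: algebra_simps)
  qed
  then show "(\<integral>x. S B x \<partial>iid_measure p) = 0"
    and "(\<integral>x. (S B x)^2 \<partial>iid_measure p) = real (card B) * (\<Sum>a\<in>UNIV. pmf p a * (f a)^2)"
    and "(\<integral>x. (S B x)^4 \<partial>iid_measure p) \<le> 3 * c^4 * (real (card B))^2"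
    by auto
qed

text \<open>Half-open, so that translates by multiples of the side length partition a larger cube.
  For \<open>hi \<le> lo\<close> it is empty, in agreement with the truncation in
  \<open>nat (hi - lo)\<close>.\<close>

definition cube :: "int \<Rightarrow> int \<Rightarrow> (int^'d) set" where
  "cube lo hi = {v. \<forall>i. lo \<le> v $ i \<and> v $ i < hi}"

lemma finite_card_cube:
  "finite (cube lo hi :: (int^'d) set)" (is ?fin)
  "card (cube lo hi :: (int^'d) set) = nat (hi - lo) ^ CARD('d)" (is ?card)
proof -
  let ?P = "PiE (UNIV :: 'd set) (\<lambda>_. {lo..<hi})"
  have eq: "(cube lo hi :: (int^'d) set) = vec_lambda ` ?P"
  proof (intro set_eqI iffI)
    fix v :: "int^'d" assume "v \<in> cube lo hi"
    then show "v \<in> vec_lambda ` ?P"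
      by (intro image_eqI[of _ _ "vec_nth v"]) (auto simp: cube_def)
  qed (auto simp: cube_def)
  have "inj_on (vec_lambda :: ('d \<Rightarrow> int) \<Rightarrow> _) ?P"
    by (auto simp: inj_on_def vec_lambda_inject)
  then show ?card
    unfolding eq by (subst card_image) (auto simp: card_PiE)
  show ?fin
    unfolding eq by (intro finite_imageI finite_PiE) auto
qed

lemma finite_box: "finite (box n :: (int^'d) set)"
proof -
  have "(box n :: (int^'d) set) \<subseteq> cube (- int n) (int n + 1)"
    by (auto simp: box_def cube_def abs_le_iff minus_le_iff)
  then show ?thesis using finite_card_cube(1) by (rule finite_subset)
qed

section \<open>Information and entropy of a probability vector\<close>

text \<open>A symbol of probability 0 has information 0, by the conventions \<open>1 / 0 = 0\<close>
  and \<open>ln 0 = 0\<close>; hence the information is finite everywhere.\<close>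

lemma info_fun_nonneg: "0 \<le> info_fun p a"
  by (cases "pmf p a = 0") (auto simp: info_fun_def pmf_le_1 pmf_pos)

lemma info_fun_bounded:
  fixes p :: "'a::finite pmf"
  obtains C where "\<And>a. info_fun p a \<le> C"
  by (rule that[of "Max (range (info_fun p))"]) auto

lemma sum_pmf_info: "(\<Sum>a\<in>UNIV. pmf p a * info_fun p a) = entropy_pv p"
proof -
  have "pmf p a * info_fun p a = - (pmf p a * ln (pmf p a))" for a
    by (cases "pmf p a = 0") (auto simp: info_fun_def ln_div)
  then show ?thesis by (simp add: entropy_pv_def sum_negf)
qed

lemma entropy_bounds:
  fixes r :: "'c::finite pmf" and C :: real
  assumes "\<And>a. info_fun r a \<le> C"
  shows "0 \<le> entropy_pv r" "entropy_pv r \<le> C"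
proof -
  show "0 \<le> entropy_pv r"
    unfolding sum_pmf_info[symmetric] by (intro sum_nonneg mult_nonneg_nonneg info_fun_nonneg) auto
  have "entropy_pv r \<le> (\<Sum>a\<in>UNIV. pmf r a * C)"
    unfolding sum_pmf_info[symmetric] by (intro sum_mono mult_left_mono assms) auto
  also have "\<dots> = C" by (simp add: sum_distrib_right[symmetric] sum_pmf_eq_1)
  finally show "entropy_pv r \<le> C" .
qed

text \<open>The information and its mean both lie between 0 and \<open>C\<close>, so their
  difference costs only \<open>C\<close>.\<close>

lemma abs_centred_info_le:
  fixes r :: "'c::finite pmf" and C :: real
  assumes "\<And>a. info_fun r a \<le> C"
  shows "\<bar>info_fun r a - entropy_pv r\<bar> \<le> C"
  using entropy_bounds[OF assms] info_fun_nonneg[of r a] assms[of a] by (auto simp: abs_le_iff)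

lemma mean_centred_info:
  fixes r :: "'c::finite pmf"
  shows "(\<Sum>a\<in>UNIV. pmf r a * (info_fun r a - entropy_pv r)) = 0"
  by (simp add: right_diff_distrib sum_subtractf sum_pmf_info sum_distrib_right[symmetric] sum_pmf_eq_1)

lemma variance_info:
  fixes r :: "'c::finite pmf"
  shows "prob_space.variance (iid_measure r :: (int^'d \<Rightarrow> 'c) measure) (\<lambda>x. info_fun r (x 0))
      = (\<Sum>a\<in>UNIV. pmf r a * (info_fun r a - entropy_pv r)^2)"
  using integral_coord_iid[where f = "\<lambda>a. (info_fun r a - entropy_pv r)^2" and p = r and v = "0 :: int^'d"]
  by (simp add: integral_coord_iid[where f = "info_fun r"] sum_pmf_info)

section \<open>Tiling a large cube by translates of a smaller one\<close>

lemma shift_shift: "shift u (shift v x) = shift (u + v) x"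
  by (simp add: shift_def algebra_simps)

definition scale_vec :: "int \<Rightarrow> int^'d \<Rightarrow> int^'d" where
  "scale_vec l i = (\<chi> c. l * i $ c)"

text \<open>Coordinatewise division by \<open>l\<close> writes each point uniquely as
  \<open>w + scale_vec l i\<close>: the quotient \<open>i\<close> names the tile, the remainder
  \<open>w\<close> the place in it.\<close>

lemma sum_cube_tiling:
  fixes f :: "int^'d \<Rightarrow> real"
  assumes l: "0 < l"
  shows "(\<Sum>v\<in>cube 0 (l * m). f v) = (\<Sum>i\<in>cube 0 m. \<Sum>w\<in>cube 0 l. f (w + scale_vec l i))"
proof -
  let ?g = "\<lambda>v::int^'d. \<chi> c. v $ c div l"
  have range: "?g v \<in> cube 0 m" if "v \<in> cube 0 (l * m)" for v
  proof -
    have "v $ c div l < m" for c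
    proof (rule ccontr)
      assume "\<not> v $ c div l < m"
      then have "l * m \<le> l * (v $ c div l)" using l by (intro mult_left_mono) auto
      also have "\<dots> \<le> v $ c" using l by (simp add: minus_mod_eq_mult_div [symmetric])
      finally show False using that by (auto simp: cube_def not_less[symmetric])
    qed
    then show ?thesis
      using that l by (auto simp: cube_def pos_imp_zdiv_nonneg_iff)
  qed
  have "(\<Sum>v\<in>cube 0 (l * m). f v) = (\<Sum>i\<in>cube 0 m. \<Sum>v\<in>{v\<in>cube 0 (l * m). ?g v = i}. f v)"
    using range by (intro sum.group[symmetric] finite_card_cube) auto
  also have "\<dots> = (\<Sum>i\<in>cube 0 m. \<Sum>w\<in>cube 0 l. f (w + scale_vec l i))"
  proof (rule sum.cong[OF refl])
    fix i :: "int^'d" assume i: "i \<in> cube 0 m"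
    show "(\<Sum>v\<in>{v\<in>cube 0 (l * m). ?g v = i}. f v) = (\<Sum>w\<in>cube 0 l. f (w + scale_vec l i))"
    proof (rule sum.reindex_bij_witness[where i = "\<lambda>w. w + scale_vec l i" and j = "\<lambda>v. v - scale_vec l i"])
      fix v :: "int^'d" assume v: "v \<in> {v\<in>cube 0 (l * m). ?g v = i}"
      then have "v $ c div l = i $ c" for c by (auto simp: vec_eq_iff)
      then have "v $ c - l * i $ c = v $ c mod l" for c
        by (metis minus_mult_div_eq_mod)
      then show "v - scale_vec l i \<in> cube 0 l"
        using l by (auto simp: cube_def scale_vec_def)
    next
      fix w :: "int^'d" assume w: "w \<in> cube 0 l"
      have "(w $ c + l * i $ c) div l = i $ c" for c
        using w l by (auto simp: cube_def div_pos_pos_trivial)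
      moreover have "0 \<le> w $ c + l * i $ c" "w $ c + l * i $ c < l * m" for c
      proof -
        have wc: "0 \<le> w $ c" "w $ c < l" and ic: "0 \<le> i $ c" "i $ c + 1 \<le> m"
          using w i by (auto simp: cube_def add1_zle_eq)
        then show "0 \<le> w $ c + l * i $ c" using l by simp
        have "l * (i $ c + 1) \<le> l * m" using ic l by (intro mult_left_mono) auto
        then show "w $ c + l * i $ c < l * m" using wc by (simp add: algebra_simps)
      qed
      ultimately show "w + scale_vec l i \<in> {v\<in>cube 0 (l * m). ?g v = i}"
        by (auto simp: cube_def scale_vec_def vec_eq_iff)
    qed auto
  qed
  finally show ?thesis .
qed

subsection \<open>Local approximations of a homomorphism\<close>

locale iid_homomorphism =
  fixes p :: "'a::finite pmf" and q :: "'b::finite pmf"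
    and \<phi> :: "(int^'d \<Rightarrow> 'a) \<Rightarrow> (int^'d \<Rightarrow> 'b)" and C :: real
  assumes hom: "is_homomorphism (iid_measure p) (iid_measure q) \<phi>"
    and ent: "entropy_pv p = entropy_pv q"
    and info_p_le: "\<And>a. info_fun p a \<le> C" and info_q_le: "\<And>b. info_fun q b \<le> C"
begin

abbreviation \<mu> :: "(int^'d \<Rightarrow> 'a) measure" where "\<mu> \<equiv> iid_measure p"

sublocale prob_space \<mu> by (rule prob_space_iid)

lemma C_nonneg: "0 \<le> C"
  using info_p_le[of undefined] info_fun_nonneg[of p undefined] by linarith

lemma measurable_phi [measurable]: "\<phi> \<in> measurable \<mu> (iid_measure q)"
  and phi_shift: "AE x in \<mu>. \<forall>u. \<phi> (shift u x) = shift u (\<phi> x)"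
  and distr_phi: "distr \<mu> (iid_measure q) \<phi> = iid_measure q"
  using hom by (auto simp: is_homomorphism_def)

text \<open>Unlike in \<open>coding_radius\<close>, the symbol \<open>b\<close> is not tied to
  \<open>\<phi> x 0\<close>, so this is a property of the pattern of \<open>x\<close> on
  \<open>box n\<close> alone. It holds vacuously for patterns of measure zero.\<close>

definition codes :: "nat \<Rightarrow> (int^'d \<Rightarrow> 'a) \<Rightarrow> 'b \<Rightarrow> bool" where
  "codes n x b \<longleftrightarrow> (AE a in \<mu>. (\<forall>i\<in>box n. a i = x i) \<longrightarrow> \<phi> a 0 = b)"

definition determined :: "nat \<Rightarrow> (int^'d \<Rightarrow> 'a) \<Rightarrow> bool" where
  "determined n x \<longleftrightarrow> (\<exists>b. codes n x b)"

text \<open>Arbitrary unless the pattern on the box determines the symbol at the origin.\<close>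
definition code :: "nat \<Rightarrow> (int^'d \<Rightarrow> 'a) \<Rightarrow> 'b" where
  "code n x = (SOME b. codes n x b)"

definition undet :: "nat \<Rightarrow> (int^'d \<Rightarrow> 'a) \<Rightarrow> real" where
  "undet n x = (if determined n x then 0 else 1)"

lemma codes_code: "determined n x \<Longrightarrow> codes n x (code n x)"
  unfolding determined_def code_def by (rule someI_ex)

lemma depends_on_codes: "depends_on (box n) (codes n)"
proof (rule depends_onI)
  fix x y :: "int^'d \<Rightarrow> 'a"
  assume "\<And>i. i \<in> box n \<Longrightarrow> x i = y i"
  then have "(\<forall>i\<in>box n. a i = x i) \<longleftrightarrow> (\<forall>i\<in>box n. a i = y i)" for a by auto
  then show "codes n x = codes n y"
    by (simp add: codes_def fun_eq_iff)
qed

lemma depends_on_determined: "depends_on (box n) (determined n)"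
  unfolding determined_def[abs_def] by (rule depends_on_comp[OF depends_on_codes])

lemma depends_on_code: "depends_on (box n) (code n)"
  unfolding code_def[abs_def] by (rule depends_on_comp[OF depends_on_codes])

lemma depends_on_undet: "depends_on (box n) (undet n)"
  unfolding undet_def[abs_def] by (rule depends_on_comp[OF depends_on_determined])

text \<open>The exceptional null set in \<open>codes\<close> varies with the pattern, but the box
  carries only finitely many patterns, so one null set serves all of them.\<close>

lemma AE_code: "AE x in \<mu>. determined n x \<longrightarrow> \<phi> x 0 = code n x"
proof -
  let ?W = "PiE (box n :: (int^'d) set) (\<lambda>_. UNIV :: 'a set)"
  have "AE a in \<mu>. \<forall>w\<in>?W. determined n w \<longrightarrow> (\<forall>i\<in>box n. a i = w i) \<longrightarrow> \<phi> a 0 = code n w"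
  proof (rule AE_finite_allI)
    show "finite ?W" using finite_box by (intro finite_PiE) auto
    fix w assume "w \<in> ?W"
    show "AE a in \<mu>. determined n w \<longrightarrow> (\<forall>i\<in>box n. a i = w i) \<longrightarrow> \<phi> a 0 = code n w"
      using codes_code[of n w] by (cases "determined n w") (auto simp: codes_def)
  qed
  then show ?thesis
  proof (rule AE_mp, intro AE_I2 impI)
    fix a assume *: "\<forall>w\<in>?W. determined n w \<longrightarrow> (\<forall>i\<in>box n. a i = w i) \<longrightarrow> \<phi> a 0 = code n w" and "determined n a"
    then show "\<phi> a 0 = code n a"
      using bspec[OF *, of "restrict a (box n)"]
      by (simp add: depends_on_restrict[OF depends_on_determined] depends_on_restrict[OF depends_on_code])
  qed
qed

lemma AE_code_shift:
  "AE x in \<mu>. determined n (shift (- v) x) \<longrightarrow> \<phi> x v = code n (shift (- v) x)"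
  using AE_shift_iid[OF AE_code[of n], of "- v"] phi_shift
proof eventually_elim
  case (elim x)
  from elim(2) have "\<phi> (shift (- v) x) 0 = shift (- v) (\<phi> x) 0" by simp
  with elim(1) show ?case by (simp add: shift_def)
qed

text \<open>Up to a null set, the cylinder of \<open>a\<close> on \<open>L\<close> lies in the
  preimage under \<open>\<phi>\<close> of the cylinder of the coded symbols on \<open>K\<close>.
  Since \<phi> carries \<mu> to the i.i.d. measure of \<open>q\<close>, comparing measures gives the
  two products.\<close>

lemma cylinder_le:
  assumes "finite L" "K \<subseteq> L" "\<And>v. v \<in> K \<Longrightarrow> determined n (shift (- v) a)"
    and "\<And>v w. v \<in> K \<Longrightarrow> w \<in> box n \<Longrightarrow> w + v \<in> L"
  shows "(\<Prod>v\<in>L. pmf p (a v)) \<le> (\<Prod>v\<in>K. pmf q (code n (shift (- v) a)))"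
proof -
  have finK: "finite K" using assms(2,1) by (rule finite_subset)
  let ?b = "\<lambda>v. code n (shift (- v) a)"
  let ?B = "{y. \<forall>v\<in>K. y v = ?b v}"
  have B: "?B \<in> sets (iid_measure q)"
    using finK by (intro sets_depends_on[of K] depends_onI) auto
  have "AE x in \<mu>. \<forall>v\<in>K. determined n (shift (- v) x) \<longrightarrow> \<phi> x v = code n (shift (- v) x)"
    using finK AE_code_shift by (intro AE_finite_allI)
  then have "AE x in \<mu>. x \<in> {x. \<forall>v\<in>L. x v = a v} \<longrightarrow> x \<in> \<phi> -` ?B \<inter> space \<mu>"
  proof eventually_elim
    case (elim x)
    show ?case
    proof
      assume x: "x \<in> {x. \<forall>v\<in>L. x v = a v}"
      have "\<phi> x v = ?b v" if v: "v \<in> K" for v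
      proof -
        have eq: "shift (- v) x i = shift (- v) a i" if "i \<in> box n" for i
          using x assms(4)[OF v that] by (simp add: shift_def)
        have "determined n (shift (- v) x) = determined n (shift (- v) a)"
          using depends_on_determined eq by (rule depends_onD)
        moreover have "code n (shift (- v) x) = code n (shift (- v) a)"
          using depends_on_code eq by (rule depends_onD)
        ultimately show ?thesis using elim v assms(3) by auto
      qed
      then show "x \<in> \<phi> -` ?B \<inter> space \<mu>" by simp
    qed
  qed
  then have "prob {x. \<forall>v\<in>L. x v = a v} \<le> prob (\<phi> -` ?B \<inter> space \<mu>)"
    using measurable_sets[OF measurable_phi B] by (rule finite_measure_mono_AE)
  also have "\<dots> = measure (distr \<mu> (iid_measure q) \<phi>) ?B"
    using B by (subst measure_distr[OF measurable_phi]) auto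
  finally show ?thesis
    using assms(1) finK by (simp add: distr_phi measure_cylinder_iid)
qed

text \<open>A local lower substitute for the information of \<open>Y\<close> minus that of
  \<open>X\<close> at the origin. The penalty outweighs the information of the arbitrary value of
  \<open>code\<close> where nothing is determined.\<close>

definition gain :: "nat \<Rightarrow> (int^'d \<Rightarrow> 'a) \<Rightarrow> real" where
  "gain n x = info_fun q (code n x) - info_fun p (x 0) - C * undet n x"

lemma depends_on_gain: "depends_on (box n) (gain n)"
proof (rule depends_onI)
  fix x y :: "int^'d \<Rightarrow> 'a" assume eq: "\<And>i. i \<in> box n \<Longrightarrow> x i = y i"
  then have "x 0 = y 0" by (simp add: box_def)
  then show "gain n x = gain n y"
    using depends_onD[OF depends_on_code[of n], of x y] depends_onD[OF depends_on_undet[of n], of x y] eq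
    by (simp add: gain_def)
qed

lemma AE_pmf_pos: "AE x in \<mu>. pmf p (x v) > 0"
proof (rule AE_distrD[OF measurable_coord_pmf])
  show "AE a in distr \<mu> (measure_pmf p) (\<lambda>x. x v). 0 < pmf p a"
    unfolding distr_coord_iid by (simp add: AE_measure_pmf_iff pmf_positive)
qed

text \<open>The logarithm of \<open>cylinder_le\<close>, applied to the determined sites of
  \<open>K\<close>. Each site of \<open>L - K\<close> carries at most \<open>C\<close> of
  information of \<open>X\<close>.\<close>

lemma AE_sum_gain_le:
  assumes L: "finite L" "K \<subseteq> L" and nb: "\<And>v w. v \<in> K \<Longrightarrow> w \<in> box n \<Longrightarrow> w + v \<in> L"
  shows "AE x in \<mu>. (\<Sum>v\<in>K. gain n (shift (- v) x)) \<le> C * real (card (L - K))"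
proof -
  have "AE x in \<mu>. \<forall>v\<in>L. pmf p (x v) > 0"
    using L AE_pmf_pos by (intro AE_finite_allI)
  then show ?thesis
  proof eventually_elim
    case (elim x)
    let ?b = "\<lambda>v. code n (shift (- v) x)"
    let ?D = "{v\<in>K. determined n (shift (- v) x)}"
    have "finite K" using L(2,1) by (rule finite_subset)
    then have finK: "finite K" "finite ?D" by auto
    have le: "(\<Prod>v\<in>L. pmf p (x v)) \<le> (\<Prod>v\<in>?D. pmf q (?b v))"
      using L nb by (intro cylinder_le) auto
    \<comment> \<open>Positivity passes through \<open>le\<close> to the coded symbols, so no
      logarithm below is taken at its default value \<open>ln 0 = 0\<close>.\<close>
    have posL: "0 < (\<Prod>v\<in>L. pmf p (x v))" using elim by (intro prod_pos) auto
    then have "(\<Prod>v\<in>?D. pmf q (?b v)) \<noteq> 0" using le by linarith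
    then have posD: "0 < pmf q (?b v)" if "v \<in> ?D" for v
      using that finK by (auto simp: less_le pmf_nonneg)
    have "(\<Sum>v\<in>L. ln (pmf p (x v))) \<le> (\<Sum>v\<in>?D. ln (pmf q (?b v)))"
    proof -
      have "0 < (\<Prod>v\<in>?D. pmf q (?b v))" using le posL by linarith
      then have "ln (\<Prod>v\<in>L. pmf p (x v)) \<le> ln (\<Prod>v\<in>?D. pmf q (?b v))"
        using le posL by simp
      moreover have "ln (\<Prod>v\<in>L. pmf p (x v)) = (\<Sum>v\<in>L. ln (pmf p (x v)))"
        using elim L by (intro ln_prod) auto
      moreover have "ln (\<Prod>v\<in>?D. pmf q (?b v)) = (\<Sum>v\<in>?D. ln (pmf q (?b v)))"
        using finK(2) posD by (intro ln_prod) force+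
      ultimately show ?thesis by simp
    qed
    moreover have "info_fun p (x v) = - ln (pmf p (x v))" if "v \<in> L" for v
      using elim that by (simp add: info_fun_def ln_div)
    moreover have "info_fun q (?b v) = - ln (pmf q (?b v))" if "v \<in> ?D" for v
      using posD[OF that] by (simp add: info_fun_def ln_div)
    ultimately have 1: "(\<Sum>v\<in>?D. info_fun q (?b v)) \<le> (\<Sum>v\<in>L. info_fun p (x v))"
      by (simp add: sum_negf)
    have 2: "(\<Sum>v\<in>L. info_fun p (x v)) \<le> (\<Sum>v\<in>K. info_fun p (x v)) + C * real (card (L - K))"
    proof -
      have "(\<Sum>v\<in>L. info_fun p (x v)) = (\<Sum>v\<in>L - K. info_fun p (x v)) + (\<Sum>v\<in>K. info_fun p (x v))"
        using L by (rule sum.subset_diff[rotated])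
      moreover have "(\<Sum>v\<in>L - K. info_fun p (x v)) \<le> (\<Sum>v\<in>L - K. C)"
        by (intro sum_mono info_p_le)
      ultimately show ?thesis by (simp add: mult.commute)
    qed
    \<comment> \<open>At an undetermined site the summand is an information minus \<open>C\<close>,
      hence at most 0.\<close>
    have 3: "(\<Sum>v\<in>K. info_fun q (?b v) - C * undet n (shift (- v) x)) \<le> (\<Sum>v\<in>?D. info_fun q (?b v))"
    proof -
      have "(\<Sum>v\<in>K. info_fun q (?b v) - C * undet n (shift (- v) x))
          \<le> (\<Sum>v\<in>K. if determined n (shift (- v) x) then info_fun q (?b v) else 0)"
        by (intro sum_mono) (auto simp: undet_def info_q_le)
      also have "\<dots> = (\<Sum>v\<in>?D. info_fun q (?b v))"
        using finK(1) by (simp add: sum.inter_filter)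
      finally show ?thesis .
    qed
    have "(\<Sum>v\<in>K. gain n (shift (- v) x))
        = (\<Sum>v\<in>K. info_fun q (?b v) - C * undet n (shift (- v) x)) - (\<Sum>v\<in>K. info_fun p (x v))"
      by (simp add: gain_def shift_def sum_subtractf)
    then show ?case using 1 2 3 by linarith
  qed
qed

subsection \<open>Tilting by a product density\<close>

definition cube_gain :: "nat \<Rightarrow> int \<Rightarrow> (int^'d \<Rightarrow> 'a) \<Rightarrow> real" where
  "cube_gain n l x = (\<Sum>v\<in>cube 0 l. gain n (shift (- v) x))"

lemma depends_on_cube_gain: "depends_on (cube (- int n) (l + int n)) (cube_gain n l)"
  unfolding cube_gain_def[abs_def]
proof (intro depends_on_sum depends_on_shift[OF depends_on_gain])
  fix v w :: "int^'d" assume "v \<in> cube 0 l" "w \<in> box n"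
  then have "0 \<le> v $ c \<and> v $ c < l \<and> - int n \<le> w $ c \<and> w $ c \<le> int n" for c
    by (auto simp: cube_def box_def abs_le_iff minus_le_iff)
  then have "- int n \<le> (w + v) $ c \<and> (w + v) $ c < l + int n" for c
    by (simp add: add.commute) (smt (verit))
  then show "w + v \<in> cube (- int n) (l + int n)"
    by (simp add: cube_def)
qed

text \<open>The bound \<open>AE_sum_gain_le\<close> on a cube made of \<open>m ^ CARD('d)\<close>
  tiles is integrated against a product density, nonnegative because
  \<open>\<bar>\<psi> x\<bar> \<le> 1\<close> and of mass 1 because \<psi> is centred. By
  independence and shift invariance all tiles contribute equally.\<close>

lemma tilted_gain_finite_tiling:
  assumes l: "0 < l"
    and dep: "depends_on (cube (int n) (l - int n)) \<psi>"
    and bd: "\<And>x. \<bar>\<psi> x\<bar> \<le> 1" and mean: "expectation \<psi> = 0"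
  shows "real m ^ CARD('d) * expectation (\<lambda>x. (1 + \<psi> x) * cube_gain n l x)
    \<le> C * real (card (cube (- int n) (l * int m + int n) - cube 0 (l * int m) :: (int^'d) set))"
proof -
  define J :: "(int^'d) set" where "J = cube 0 (int m)"
  let ?L = "cube (- int n) (l * int m + int n) :: (int^'d) set" and ?K = "cube 0 (l * int m) :: (int^'d) set"
  define c where "c = C * real (card (?L - ?K))"
  have finJ: "finite J" and cardJ: "card J = m ^ CARD('d)"
    by (auto simp: J_def finite_card_cube)
  define g where "g = (\<lambda>i x. 1 + \<psi> (shift (- scale_vec l i) x))"
  define H where "H = (\<lambda>i x. cube_gain n l (shift (- scale_vec l i) x))"
  \<comment> \<open>\<open>B i\<close> supports the \<open>i\<close>-th factor of the density, and \<open>E i\<close> the gain of the \<open>i\<close>-th tile; the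
    margin \<open>n\<close> on both sides keeps \<open>E i\<close> away from \<open>B j\<close> for \<open>j \<noteq> i\<close>.\<close>
  define B where "B = (\<lambda>i::int^'d. (\<lambda>w. w + scale_vec l i) ` cube (int n) (l - int n))"
  define E where "E = (\<lambda>i::int^'d. (\<lambda>w. w + scale_vec l i) ` cube (- int n) (l + int n))"
  have finB: "finite (B i)" and finE: "finite (E i)" for i
    by (auto simp: B_def E_def finite_card_cube)
  have EB: "E i \<inter> B j = {}" if "i \<noteq> j" for i j
  proof -
    from that obtain k where k: "i $ k \<noteq> j $ k" by (auto simp: vec_eq_iff)
    have False if v: "v \<in> E i" "v \<in> B j" for v
    proof -
      from v(1) have "l * i $ k - int n \<le> v $ k" "v $ k < l * i $ k + l + int n"
        by (auto simp: E_def cube_def scale_vec_def)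
      moreover from v(2) have "l * j $ k + int n \<le> v $ k" "v $ k < l * j $ k + l - int n"
        by (auto simp: B_def cube_def scale_vec_def)
      ultimately have 1: "l * i $ k - int n \<le> v $ k" "v $ k < l * i $ k + l + int n"
        "l * j $ k + int n \<le> v $ k" "v $ k < l * j $ k + l - int n" by auto
      show False
      proof (cases "i $ k < j $ k")
        case True
        then have "l * (i $ k + 1) \<le> l * j $ k" using l by (intro mult_left_mono) auto
        then show ?thesis using 1 by (simp add: algebra_simps)
      next
        case False
        then have "l * (j $ k + 1) \<le> l * i $ k" using k l by (intro mult_left_mono) auto
        then show ?thesis using 1 by (simp add: algebra_simps)
      qed
    qed
    then show ?thesis by auto
  qed
  have BE: "B i \<subseteq> E i" for i
    unfolding B_def E_def by (intro image_mono) (auto simp: cube_def; smt (verit) of_nat_0_le_iff)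
  have disjB: "disjoint_family_on B A" for A
    using EB BE by (auto simp: disjoint_family_on_def) blast
  have depg: "depends_on (B i) (g i)" for i
    unfolding g_def by (intro depends_on_comp[where g = "\<lambda>y. 1 + y"] depends_on_shift[OF dep]) (auto simp: B_def)
  have depH: "depends_on (E i) (H i)" for i
    unfolding H_def by (intro depends_on_shift[OF depends_on_cube_gain]) (auto simp: E_def)
  have g0: "0 \<le> g i x" for i x
    using bd[of "shift (- scale_vec l i) x"] by (auto simp: g_def abs_le_iff)
  have mpsi: "\<psi> \<in> borel_measurable \<mu>"
    by (rule measurable_depends_on[OF finite_card_cube(1) dep])
  have mH: "cube_gain n l \<in> borel_measurable \<mu>"
    by (rule measurable_depends_on[OF finite_card_cube(1) depends_on_cube_gain])
  have intpsi: "integrable \<mu> \<psi>"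
    by (rule integrable_depends_on[OF finite_card_cube(1) dep])
  have Eg: "expectation (g i) = 1" for i
  proof -
    have "expectation (g i) = expectation (\<lambda>x. 1 + \<psi> x)"
      unfolding g_def using mpsi by (subst integral_shift_iid[where F = "\<lambda>x. 1 + \<psi> x"]) auto
    also have "\<dots> = 1" using intpsi mean prob_space by simp
    finally show ?thesis .
  qed
  have EG: "expectation (\<lambda>x. \<Prod>i\<in>J. g i x) = 1"
    using integral_mult_prod_indep[of J "{}" B "\<lambda>_. 1" g p] finJ finB disjB depg Eg prob_space
    by (simp add: depends_on_def)
  \<comment> \<open>Factor \<open>i\<close> stays with \<open>H i\<close>, as both live on
    \<open>E i\<close>; the other factors integrate out, and a shift moves the tile back to the
    origin.\<close>
  have EGH: "expectation (\<lambda>x. (\<Prod>j\<in>J. g j x) * H i x) = expectation (\<lambda>x. (1 + \<psi> x) * cube_gain n l x)"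
    if i: "i \<in> J" for i
  proof -
    have "depends_on (E i) (\<lambda>x. g i x * H i x)"
      using depends_on_mono[OF depg BE] depH by (rule depends_on_comp2[where g = "(*)"])
    then have "expectation (\<lambda>x. (g i x * H i x) * (\<Prod>j\<in>J - {i}. g j x)) = expectation (\<lambda>x. g i x * H i x)"
      using finJ by (intro integral_mult_prod_indep[of "J - {i}" "E i" B] finB finE EB disjB depg Eg) auto
    moreover have "(\<Prod>j\<in>J. g j x) * H i x = (g i x * H i x) * (\<Prod>j\<in>J - {i}. g j x)" for x
      using prod.remove[OF finJ i, of "\<lambda>j. g j x"] by simp
    ultimately have "expectation (\<lambda>x. (\<Prod>j\<in>J. g j x) * H i x) = expectation (\<lambda>x. g i x * H i x)"
      by (simp only:)
    also have "\<dots> = expectation (\<lambda>x. (1 + \<psi> x) * cube_gain n l x)"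
      unfolding g_def H_def using mpsi mH
      by (subst integral_shift_iid[where F = "\<lambda>x. (1 + \<psi> x) * cube_gain n l x"]) auto
    finally show ?thesis .
  qed
  have AE: "AE x in \<mu>. (\<Sum>i\<in>J. H i x) \<le> c"
  proof -
    have "(\<Sum>v\<in>?K. gain n (shift (- v) x)) = (\<Sum>i\<in>J. H i x)" for x
      using sum_cube_tiling[OF l, where m = "int m" and f = "\<lambda>v. gain n (shift (- v) x)"]
      by (simp add: H_def cube_gain_def J_def shift_shift)
    moreover have "AE x in \<mu>. (\<Sum>v\<in>?K. gain n (shift (- v) x)) \<le> C * real (card (?L - ?K))"
    proof (rule AE_sum_gain_le)
      show "?K \<subseteq> ?L" by (auto simp: cube_def; smt (verit) of_nat_0_le_iff)
      fix v w :: "int^'d" assume "v \<in> ?K" "w \<in> box n"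
      then have "0 \<le> v $ c \<and> v $ c < l * int m \<and> - int n \<le> w $ c \<and> w $ c \<le> int n" for c
        by (auto simp: cube_def box_def abs_le_iff minus_le_iff)
      then have "- int n \<le> (w + v) $ c \<and> (w + v) $ c < l * int m + int n" for c
        by (simp add: add.commute) (smt (verit))
      then show "w + v \<in> ?L" by (simp add: cube_def)
    qed (rule finite_card_cube)
    ultimately show ?thesis by (simp add: c_def)
  qed
  have depG: "depends_on (\<Union>j\<in>J. E j) (\<lambda>x. \<Prod>j\<in>J. g j x)"
    using BE by (intro depends_on_prod depends_on_mono[OF depg]) auto
  have intG: "integrable \<mu> (\<lambda>x. \<Prod>j\<in>J. g j x)"
    using finJ finE by (intro integrable_depends_on[OF _ depG]) auto
  have intGH: "integrable \<mu> (\<lambda>x. (\<Prod>j\<in>J. g j x) * H i x)" if "i \<in> J" for i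
  proof (rule integrable_depends_on)
    show "depends_on (\<Union>j\<in>J. E j) (\<lambda>x. (\<Prod>j\<in>J. g j x) * H i x)"
      using that by (intro depends_on_comp2[where g = "(*)"] depG depends_on_mono[OF depH]) auto
  qed (use finJ finE in auto)
  have "real m ^ CARD('d) * expectation (\<lambda>x. (1 + \<psi> x) * cube_gain n l x)
      = (\<Sum>i\<in>J. expectation (\<lambda>x. (\<Prod>j\<in>J. g j x) * H i x))"
    using cardJ by (simp add: EGH)
  also have "\<dots> = expectation (\<lambda>x. (\<Prod>j\<in>J. g j x) * (\<Sum>i\<in>J. H i x))"
    using intGH by (simp add: sum_distrib_left)
  also have "\<dots> \<le> expectation (\<lambda>x. (\<Prod>j\<in>J. g j x) * c)"
  proof (rule integral_mono_AE)
    show "integrable \<mu> (\<lambda>x. (\<Prod>j\<in>J. g j x) * (\<Sum>i\<in>J. H i x))"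
      using intGH by (simp add: sum_distrib_left)
    show "AE x in \<mu>. (\<Prod>j\<in>J. g j x) * (\<Sum>i\<in>J. H i x) \<le> (\<Prod>j\<in>J. g j x) * c"
      using AE by eventually_elim (intro mult_left_mono prod_nonneg ballI g0)
  qed (use intG in auto)
  also have "\<dots> = c" using EG by simp
  finally show ?thesis by (simp add: c_def)
qed

text \<open>After division by \<open>m ^ CARD('d)\<close> the boundary term becomes a multiple of
  \<open>(l + 2 * n / m) ^ CARD('d) - l ^ CARD('d)\<close>. It vanishes as \<open>m\<close> grows,
  while the left-hand side does not involve \<open>m\<close>.\<close>

lemma tilted_gain_nonpos:
  assumes l: "0 < l"
    and dep: "depends_on (cube (int n) (l - int n)) \<psi>"
    and bd: "\<And>x. \<bar>\<psi> x\<bar> \<le> 1" and mean: "expectation \<psi> = 0"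
  shows "expectation (\<lambda>x. (1 + \<psi> x) * cube_gain n l x) \<le> 0"
proof -
  let ?e = "expectation (\<lambda>x. (1 + \<psi> x) * cube_gain n l x)"
  let ?d = "CARD('d)"
  have le: "?e \<le> C * ((real_of_int l + 2 * real n / real m) ^ ?d - real_of_int l ^ ?d)" if m: "0 < m" for m :: nat
  proof -
    let ?L = "cube (- int n) (l * int m + int n) :: (int^'d) set" and ?K = "cube 0 (l * int m) :: (int^'d) set"
    have lm: "0 \<le> l * int m" using l by simp
    have sub: "?K \<subseteq> ?L" by (auto simp: cube_def; smt (verit) of_nat_0_le_iff)
    have "real (card (?L - ?K)) = real (card ?L) - real (card ?K)"
      using sub by (simp add: card_Diff_subset finite_card_cube(1) card_mono of_nat_diff)
    also have "\<dots> = (real_of_int l * real m + 2 * real n) ^ ?d - (real_of_int l * real m) ^ ?d"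
      using lm by (simp add: finite_card_cube(2) algebra_simps)
    also have "\<dots> = (real m * (real_of_int l + 2 * real n / real m)) ^ ?d - (real m * real_of_int l) ^ ?d"
    proof -
      have "real_of_int l * real m + 2 * real n = real m * (real_of_int l + 2 * real n / real m)"
        using m by (simp add: field_simps)
      then show ?thesis by (simp only: mult.commute[of "real m" "real_of_int l"])
    qed
    also have "\<dots> = real m ^ ?d * ((real_of_int l + 2 * real n / real m) ^ ?d - real_of_int l ^ ?d)"
      by (simp add: power_mult_distrib right_diff_distrib)
    finally have "real m ^ ?d * ?e
        \<le> C * (real m ^ ?d * ((real_of_int l + 2 * real n / real m) ^ ?d - real_of_int l ^ ?d))"
      using tilted_gain_finite_tiling[OF assms, of m] by simp
    also have "\<dots> = real m ^ ?d * (C * ((real_of_int l + 2 * real n / real m) ^ ?d - real_of_int l ^ ?d))"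
      by simp
    finally show ?thesis using m by (simp add: mult_le_cancel_left_pos)
  qed
  have "(\<lambda>m. C * ((real_of_int l + 2 * real n / real m) ^ ?d - real_of_int l ^ ?d))
      \<longlonglongrightarrow> C * ((real_of_int l + 0) ^ ?d - real_of_int l ^ ?d)"
    by (intro tendsto_intros lim_const_over_n)
  then have "(\<lambda>m. C * ((real_of_int l + 2 * real n / real m) ^ ?d - real_of_int l ^ ?d)) \<longlonglongrightarrow> 0"
    by simp
  then show ?thesis
    by (rule LIMSEQ_le_const) (use le in \<open>auto intro!: exI[of _ 1]\<close>)
qed

subsection \<open>Moments of the information difference\<close>

definition infosum :: "(int^'d) set \<Rightarrow> (int^'d \<Rightarrow> 'a) \<Rightarrow> real" where
  "infosum B x = (\<Sum>v\<in>B. info_fun p (x v) - entropy_pv p)"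

definition infosum' :: "(int^'d) set \<Rightarrow> (int^'d \<Rightarrow> 'a) \<Rightarrow> real" where
  "infosum' B x = (\<Sum>v\<in>B. info_fun q (\<phi> x v) - entropy_pv q)"

definition infodiff :: "(int^'d) set \<Rightarrow> (int^'d \<Rightarrow> 'a) \<Rightarrow> real" where
  "infodiff B x = (\<Sum>v\<in>B. info_fun q (\<phi> x v) - info_fun p (x v))"

definition var_p :: real where
  "var_p = (\<Sum>a\<in>UNIV. pmf p a * (info_fun p a - entropy_pv p)^2)"

definition var_q :: real where
  "var_q = (\<Sum>b\<in>UNIV. pmf q b * (info_fun q b - entropy_pv q)^2)"

text \<open>The centring constants cancel; this is where equality of the entropies enters.\<close>

lemma infodiff_eq: "infodiff B x = infosum' B x - infosum B x"
  by (simp add: infodiff_def infosum_def infosum'_def ent sum_subtractf)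

lemma infosum_moments:
  assumes "finite B"
  shows "expectation (infosum B) = 0"
    and "expectation (\<lambda>x. infosum B x ^ 2) = real (card B) * var_p"
    and "expectation (\<lambda>x. infosum B x ^ 4) \<le> 3 * C^4 * (real (card B))^2"
  using iid_sum_moments[OF assms mean_centred_info abs_centred_info_le[OF info_p_le]]
  by (simp_all add: infosum_def[abs_def] var_p_def)

lemma integral_phi:
  fixes F :: "(int^'d \<Rightarrow> 'b) \<Rightarrow> real"
  assumes "finite B" "depends_on B F"
  shows "expectation (\<lambda>x. F (\<phi> x)) = (\<integral>y. F y \<partial>iid_measure q)"
  using integral_distr[OF measurable_phi measurable_depends_on[OF assms]] by (simp add: distr_phi)

text \<open>Since \<phi> carries \<mu> to the i.i.d. measure of \<open>q\<close>, these are moments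
  of an i.i.d. sum under \<open>q\<close>.\<close>

lemma infosum'_moments:
  assumes "finite B"
  shows "expectation (infosum' B) = 0"
    and "expectation (\<lambda>x. infosum' B x ^ 2) = real (card B) * var_q"
    and "expectation (\<lambda>x. infosum' B x ^ 4) \<le> 3 * C^4 * (real (card B))^2"
proof -
  have dep: "depends_on B (\<lambda>y. (\<Sum>v\<in>B. info_fun q (y v) - entropy_pv q) ^ k)" for k
    by (rule depends_onI) (simp cong: sum.cong)
  note phi = integral_phi[OF assms dep]
  note m = iid_sum_moments[OF assms mean_centred_info abs_centred_info_le[OF info_q_le]]
  show "expectation (infosum' B) = 0"
    using phi[of 1] m(1) by (simp add: infosum'_def[abs_def])
  show "expectation (\<lambda>x. infosum' B x ^ 2) = real (card B) * var_q"
    using phi[of 2] m(2) by (simp add: infosum'_def var_q_def)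
  show "expectation (\<lambda>x. infosum' B x ^ 4) \<le> 3 * C^4 * (real (card B))^2"
    using phi[of 4] m(3) by (simp add: infosum'_def)
qed

lemma measurable_infosum [measurable]:
  "infosum B \<in> borel_measurable \<mu>" "infosum' B \<in> borel_measurable \<mu>" "infodiff B \<in> borel_measurable \<mu>"
proof -
  have [measurable]: "(\<lambda>x. info_fun q (\<phi> x v)) \<in> borel_measurable \<mu>" for v
    by (rule measurable_compose[OF measurable_phi measurable_from_coord_iid])
  show "infosum B \<in> borel_measurable \<mu>" "infosum' B \<in> borel_measurable \<mu>" "infodiff B \<in> borel_measurable \<mu>"
    unfolding infosum_def[abs_def] infosum'_def[abs_def] infodiff_def[abs_def] by measurable
qed

lemma abs_infosum_le:
  "\<bar>infosum B x\<bar> \<le> real (card B) * C" "\<bar>infosum' B x\<bar> \<le> real (card B) * C"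
  "\<bar>infodiff B x\<bar> \<le> real (card B) * C"
proof -
  have "\<bar>sum f B\<bar> \<le> real (card B) * C" if "\<And>v. \<bar>f v\<bar> \<le> C" for f :: "int^'d \<Rightarrow> real"
    using order_trans[OF sum_abs sum_bounded_above[of B "\<lambda>v. \<bar>f v\<bar>" C]] that by simp
  moreover have "\<bar>info_fun q b - info_fun p a\<bar> \<le> C" for a b
    using info_fun_nonneg[of q b] info_fun_nonneg[of p a] info_p_le[of a] info_q_le[of b]
    by (auto simp: abs_le_iff)
  ultimately show "\<bar>infosum B x\<bar> \<le> real (card B) * C" "\<bar>infosum' B x\<bar> \<le> real (card B) * C"
    "\<bar>infodiff B x\<bar> \<le> real (card B) * C"
    using abs_centred_info_le[OF info_p_le] abs_centred_info_le[OF info_q_le]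
    by (simp_all add: infosum_def infosum'_def infodiff_def)
qed

lemma integrable_bounded:
  fixes f :: "_ \<Rightarrow> real"
  assumes "f \<in> borel_measurable \<mu>" "\<And>x. \<bar>f x\<bar> \<le> b"
  shows "integrable \<mu> f"
  using assms by (intro integrable_const_bound[of _ b]) auto

lemma integrable_power_bounded:
  fixes f :: "_ \<Rightarrow> real"
  assumes "f \<in> borel_measurable \<mu>" "\<And>x. \<bar>f x\<bar> \<le> b"
  shows "integrable \<mu> (\<lambda>x. f x ^ k)"
proof (rule integrable_bounded)
  show "\<bar>f x ^ k\<bar> \<le> b ^ k" for x
    using assms(2)[of x] by (simp add: power_abs power_mono)
qed (use assms(1) in auto)

lemmas integrable_infosum [simp] =
  integrable_bounded[OF measurable_infosum(1) abs_infosum_le(1)]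
  integrable_bounded[OF measurable_infosum(2) abs_infosum_le(2)]
  integrable_bounded[OF measurable_infosum(3) abs_infosum_le(3)]
  integrable_power_bounded[OF measurable_infosum(1) abs_infosum_le(1)]
  integrable_power_bounded[OF measurable_infosum(2) abs_infosum_le(2)]
  integrable_power_bounded[OF measurable_infosum(3) abs_infosum_le(3)]

lemma expectation_infodiff:
  assumes "finite B"
  shows "expectation (infodiff B) = 0"
  using infosum_moments(1)[OF assms] infosum'_moments(1)[OF assms]
  by (simp add: infodiff_eq[abs_def])

lemma infodiff_second_moment:
  assumes "finite B"
  shows "expectation (\<lambda>x. infodiff B x ^ 2) \<le> 2 * (var_p + var_q) * real (card B)"
proof -
  have "infodiff B x ^ 2 \<le> 2 * infosum' B x ^ 2 + 2 * infosum B x ^ 2" for x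
    unfolding infodiff_eq using zero_le_power2[of "infosum' B x + infosum B x"]
    by (simp add: power2_eq_square algebra_simps)
  then have "expectation (\<lambda>x. infodiff B x ^ 2)
      \<le> expectation (\<lambda>x. 2 * infosum' B x ^ 2 + 2 * infosum B x ^ 2)"
    by (intro integral_mono) auto
  also have "\<dots> = 2 * (var_p + var_q) * real (card B)"
    using infosum_moments(2)[OF assms] infosum'_moments(2)[OF assms] by (simp add: algebra_simps)
  finally show ?thesis .
qed

text \<open>Using \<open>(a - b)^2 \<le> 2 * a^2 + 2 * b^2\<close> and its analogue for sums gives
  \<open>(a - b)^4 \<le> 8 * a^4 + 8 * b^4\<close>; each fourth moment contributes a factor 3,
  whence 48.\<close>

lemma infodiff_fourth_moment:
  assumes "finite B"
  shows "expectation (\<lambda>x. infodiff B x ^ 4) \<le> 48 * C^4 * (real (card B))^2"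
proof -
  have "infodiff B x ^ 4 \<le> 8 * infosum' B x ^ 4 + 8 * infosum B x ^ 4" for x
  proof -
    have sq: "(a - b)^2 \<le> 2 * a^2 + 2 * b^2" "(a + b)^2 \<le> 2 * a^2 + 2 * b^2" for a b :: real
      using zero_le_power2[of "a + b"] zero_le_power2[of "a - b"]
      by (simp_all add: power2_eq_square algebra_simps)
    have four: "a^4 = (a^2)^2" for a :: real by simp
    let ?a = "infosum' B x" and ?b = "infosum B x"
    have "(?a - ?b)^4 \<le> (2 * ?a^2 + 2 * ?b^2)^2"
      unfolding four[of "?a - ?b"] by (intro power_mono sq) auto
    also have "\<dots> \<le> 2 * (2 * ?a^2)^2 + 2 * (2 * ?b^2)^2" by (rule sq)
    finally show ?thesis by (simp add: infodiff_eq power_mult_distrib)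
  qed
  then have "expectation (\<lambda>x. infodiff B x ^ 4)
      \<le> expectation (\<lambda>x. 8 * infosum' B x ^ 4 + 8 * infosum B x ^ 4)"
    by (intro integral_mono) auto
  also have "\<dots> \<le> 48 * C^4 * (real (card B))^2"
    using infosum_moments(3)[OF assms] infosum'_moments(3)[OF assms] by simp
  finally show ?thesis .
qed

text \<open>Cauchy-Schwarz, in the form that the variance of the absolute value is
  nonnegative.\<close>

lemma infodiff_first_moment:
  assumes "finite B"
  shows "expectation (\<lambda>x. \<bar>infodiff B x\<bar>) \<le> sqrt (2 * (var_p + var_q) * real (card B))"
proof (rule real_le_rsqrt)
  have "0 \<le> variance (\<lambda>x. \<bar>infodiff B x\<bar>)" by (rule variance_positive)
  also have "\<dots> = expectation (\<lambda>x. \<bar>infodiff B x\<bar>^2) - (expectation (\<lambda>x. \<bar>infodiff B x\<bar>))^2"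
    by (rule variance_eq) auto
  finally show "(expectation (\<lambda>x. \<bar>infodiff B x\<bar>))^2 \<le> 2 * (var_p + var_q) * real (card B)"
    using infodiff_second_moment[OF assms] by simp
qed

section \<open>First moment of the information difference on a cube\<close>

lemma measurable_undet: "undet n \<in> borel_measurable \<mu>"
  by (rule measurable_depends_on[OF finite_box depends_on_undet])

lemma integrable_undet_shift: "integrable \<mu> (\<lambda>x. undet n (shift u x))"
proof (rule integrable_bounded)
  show "(\<lambda>x. undet n (shift u x)) \<in> borel_measurable \<mu>"
    by (rule measurable_compose[OF measurable_shift_iid measurable_undet])
  show "\<bar>undet n (shift u x)\<bar> \<le> 1" for x by (simp add: undet_def)
qed

text \<open>The inequality \<open>tilted_gain_nonpos\<close> is tested with a centred sign.
  Undetermined sites give the first error term; the frame \<open>R\<close>, which the test function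
  cannot see, is estimated by its second moment.\<close>

lemma infodiff_cube_first_moment:
  fixes n :: nat and l :: int
  assumes l: "0 < l"
  defines "K \<equiv> cube 0 l :: (int^'d) set" and "R \<equiv> cube 0 l - cube (2 * int n) (l - 2 * int n) :: (int^'d) set"
  shows "expectation (\<lambda>x. \<bar>infodiff K x\<bar>)
    \<le> 10 * C * real (card K) * expectation (undet n) + 2 * sqrt (2 * (var_p + var_q) * real (card R))"
proof -
  \<comment> \<open>The margin is \<open>2 * n\<close>: one \<open>n\<close> keeps the test function
    inside the cube allowed for \<psi>, the other is the reach of \<open>code n\<close>.\<close>
  define I :: "(int^'d) set" where "I = cube (2 * int n) (l - 2 * int n)"
  have fin: "finite K" "finite R" "finite I"
    by (auto simp: K_def R_def I_def finite_card_cube(1))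
  have IK: "I \<subseteq> K" unfolding I_def K_def cube_def by (auto; smt (verit) of_nat_0_le_iff)
  define U where "U = (\<lambda>x. \<Sum>v\<in>K. undet n (shift (- v) x))"
  define W where "W = (\<lambda>x. \<Sum>v\<in>I. info_fun q (code n (shift (- v) x)) - info_fun p (x v))"
  \<comment> \<open>The test function: half the sign of a local version of the information difference, so that
    its centring \<open>\<psi>\<close> is bounded by 1.\<close>
  define s where "s = (\<lambda>x. sgn (W x) / 2)"
  define \<psi> where "\<psi> = (\<lambda>x. s x - expectation s)"
  have depW: "depends_on (cube (int n) (l - int n)) W"
    unfolding W_def
  proof (rule depends_on_sum)
    fix v assume v: "v \<in> I"
    have nb: "w + v \<in> cube (int n) (l - int n)" if "w \<in> box n" for w
    proof -
      have "2 * int n \<le> v $ c \<and> v $ c < l - 2 * int n \<and> - int n \<le> w $ c \<and> w $ c \<le> int n" for c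
        using v that by (auto simp: I_def cube_def box_def abs_le_iff minus_le_iff)
      then have "int n \<le> (w + v) $ c \<and> (w + v) $ c < l - int n" for c
        by (simp add: add.commute) (smt (verit))
      then show ?thesis by (simp add: cube_def)
    qed
    then have 1: "depends_on (cube (int n) (l - int n)) (\<lambda>x. code n (shift (- v) x))"
      by (rule depends_on_shift[OF depends_on_code])
    have "v \<in> cube (int n) (l - int n)"
      using nb[of 0] by (simp add: box_def)
    then have 2: "depends_on (cube (int n) (l - int n)) (\<lambda>x. x v)"
      by (simp add: depends_on_def)
    show "depends_on (cube (int n) (l - int n))
        (\<lambda>x. info_fun q (code n (shift (- v) x)) - info_fun p (x v))"
      by (rule depends_on_comp2[OF 1 2])
  qed
  have deps: "depends_on (cube (int n) (l - int n)) s" and dep\<psi>: "depends_on (cube (int n) (l - int n)) \<psi>"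
    unfolding s_def \<psi>_def by (intro depends_on_comp[OF depW, where g = "\<lambda>w. sgn w / 2"]
        depends_on_comp[OF depW, where g = "\<lambda>w. sgn w / 2 - expectation (\<lambda>x. sgn (W x) / 2)"])+
  have int_s: "integrable \<mu> s" and ms: "s \<in> borel_measurable \<mu>"
    using integrable_depends_on[OF finite_card_cube(1) deps] measurable_depends_on[OF finite_card_cube(1) deps] by auto
  have s_le: "\<bar>s x\<bar> \<le> 1/2" for x by (simp add: s_def sgn_if)
  have "\<bar>expectation s\<bar> \<le> 1/2"
  proof -
    have "\<bar>expectation s\<bar> \<le> expectation (\<lambda>x. \<bar>s x\<bar>)" by (rule integral_abs_bound)
    also have "\<dots> \<le> 1/2" using s_le int_s by (intro integral_le_const) auto
    finally show ?thesis .
  qed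
  then have psi_le: "\<bar>\<psi> x\<bar> \<le> 1" for x using s_le[of x] by (simp add: \<psi>_def abs_le_iff) linarith
  have psi_mean: "expectation \<psi> = 0"
    using int_s prob_space by (simp add: \<psi>_def)
  have EU: "expectation U = real (card K) * expectation (undet n)"
    by (simp add: U_def integrable_undet_shift integral_shift_iid[OF measurable_undet])
  have int_U: "integrable \<mu> U"
    unfolding U_def by (intro Bochner_Integration.integrable_sum integrable_undet_shift)
  have undet0: "0 \<le> undet n x" for x by (simp add: undet_def)
  have AE: "AE x in \<mu>. \<forall>v\<in>K. determined n (shift (- v) x) \<longrightarrow> \<phi> x v = code n (shift (- v) x)"
    using fin(1) AE_code_shift by (intro AE_finite_allI)
  have diff: "\<bar>info_fun q b - info_fun q b'\<bar> \<le> C" for b b'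
    using info_fun_nonneg[of q b] info_fun_nonneg[of q b'] info_q_le[of b] info_q_le[of b']
    by (auto simp: abs_le_iff)
  \<comment> \<open>An undetermined site costs \<open>C\<close> for a possibly wrong symbol and
    \<open>C\<close> for the penalty in \<open>gain\<close>; a determined site costs
    nothing.\<close>
  have AE1: "AE x in \<mu>. \<bar>infodiff K x - cube_gain n l x\<bar> \<le> 2 * C * U x"
    using AE
  proof eventually_elim
    case (elim x)
    have "infodiff K x - cube_gain n l x = (\<Sum>v\<in>K. info_fun q (\<phi> x v)
        - info_fun q (code n (shift (- v) x)) + C * undet n (shift (- v) x))"
      unfolding infodiff_def cube_gain_def gain_def K_def sum_subtractf[symmetric]
      by (intro sum.cong refl) (simp add: shift_def)
    also have "\<bar>\<dots>\<bar> \<le> (\<Sum>v\<in>K. 2 * C * undet n (shift (- v) x))"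
    proof (rule order_trans[OF sum_abs sum_mono])
      fix v assume "v \<in> K"
      then show "\<bar>info_fun q (\<phi> x v) - info_fun q (code n (shift (- v) x)) + C * undet n (shift (- v) x)\<bar>
          \<le> 2 * C * undet n (shift (- v) x)"
        using elim diff[of "\<phi> x v" "code n (shift (- v) x)"] C_nonneg by (auto simp: undet_def)
    qed
    finally show ?case by (simp add: U_def sum_distrib_left)
  qed
  have AE2: "AE x in \<mu>. \<bar>infodiff I x - W x\<bar> \<le> C * U x"
    using AE
  proof eventually_elim
    case (elim x)
    have "infodiff I x - W x = (\<Sum>v\<in>I. info_fun q (\<phi> x v) - info_fun q (code n (shift (- v) x)))"
      by (simp add: infodiff_def W_def sum_subtractf[symmetric])
    also have "\<bar>\<dots>\<bar> \<le> (\<Sum>v\<in>I. C * undet n (shift (- v) x))"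
    proof (rule order_trans[OF sum_abs sum_mono])
      fix v assume "v \<in> I"
      then show "\<bar>info_fun q (\<phi> x v) - info_fun q (code n (shift (- v) x))\<bar> \<le> C * undet n (shift (- v) x)"
        using elim IK diff[of "\<phi> x v" "code n (shift (- v) x)"] by (auto simp: undet_def)
    qed
    also have "\<dots> \<le> (\<Sum>v\<in>K. C * undet n (shift (- v) x))"
      using fin IK C_nonneg by (intro sum_mono2) (auto simp: undet0)
    finally show ?case by (simp add: U_def sum_distrib_left)
  qed
  have int_sD: "integrable \<mu> (\<lambda>x. s x * infodiff K x)"
  proof (rule integrable_bounded)
    show "\<bar>s x * infodiff K x\<bar> \<le> 1/2 * (real (card K) * C)" for x
      unfolding abs_mult by (intro mult_mono s_le abs_infosum_le) auto
  qed (use ms in auto)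
  \<comment> \<open>Since \<open>0 \<le> 1 + \<psi> x \<le> 2\<close>, the error
    \<open>2 * C * U\<close> at most doubles. The constant part \<open>1 - expectation s\<close> of
    the tilt drops out because \<open>infodiff K\<close> has mean 0.\<close>
  have "expectation (\<lambda>x. s x * infodiff K x) \<le> 4 * C * expectation U"
  proof -
    have "AE x in \<mu>. (1 + \<psi> x) * infodiff K x - 4 * C * U x \<le> (1 + \<psi> x) * cube_gain n l x"
      using AE1
    proof eventually_elim
      case (elim x)
      have "(1 + \<psi> x) * (infodiff K x - cube_gain n l x) \<le> (1 + \<psi> x) * (2 * C * U x)"
        using elim psi_le[of x] by (intro mult_left_mono) (auto simp: abs_le_iff)
      also have "\<dots> \<le> 2 * (2 * C * U x)"
        using elim psi_le[of x] by (intro mult_right_mono) (auto simp: abs_le_iff)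
      finally show ?case by (simp add: algebra_simps)
    qed
    moreover have eq: "(1 + \<psi> x) * infodiff K x - 4 * C * U x
        = s x * infodiff K x + (1 - expectation s) * infodiff K x - 4 * C * U x" for x
      by (simp add: \<psi>_def algebra_simps)
    moreover have "integrable \<mu> (\<lambda>x. (1 + \<psi> x) * cube_gain n l x)"
    proof (rule integrable_depends_on)
      have "cube (int n) (l - int n) \<subseteq> (cube (- int n) (l + int n) :: (int^'d) set)"
        by (auto simp: cube_def; smt (verit) of_nat_0_le_iff)
      then show "depends_on (cube (- int n) (l + int n)) (\<lambda>x. (1 + \<psi> x) * cube_gain n l x)"
        by (intro depends_on_comp2[where g = "\<lambda>a b. (1 + a) * b"] depends_on_cube_gain
            depends_on_mono[OF dep\<psi>])
    qed (rule finite_card_cube)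
    ultimately have "expectation (\<lambda>x. s x * infodiff K x + (1 - expectation s) * infodiff K x - 4 * C * U x)
        \<le> expectation (\<lambda>x. (1 + \<psi> x) * cube_gain n l x)"
      using int_sD int_U by (intro integral_mono_AE) auto
    also have "\<dots> \<le> 0"
      by (rule tilted_gain_nonpos[OF l dep\<psi> psi_le psi_mean])
    finally show ?thesis
      using int_sD int_U expectation_infodiff[OF fin(1)] by simp
  qed
  \<comment> \<open>As \<open>s x * W x\<close> is half of \<open>\<bar>W x\<bar>\<close>, twice
    \<open>s x * infodiff K x\<close> recovers the absolute value, up to replacing \<open>W\<close>
    by \<open>infodiff I\<close> and up to the frame.\<close>
  moreover have "expectation (\<lambda>x. \<bar>infodiff K x\<bar>)
      \<le> expectation (\<lambda>x. 2 * (s x * infodiff K x) + 2 * C * U x + 2 * \<bar>infodiff R x\<bar>)"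
  proof (rule integral_mono_AE)
    show "AE x in \<mu>. \<bar>infodiff K x\<bar> \<le> 2 * (s x * infodiff K x) + 2 * C * U x + 2 * \<bar>infodiff R x\<bar>"
      using AE2
    proof eventually_elim
      case (elim x)
      have split: "infodiff K x = infodiff R x + infodiff I x"
        unfolding infodiff_def R_def K_def[symmetric] I_def[symmetric]
        using fin IK by (intro sum.subset_diff) auto
      have half: "- (\<bar>y\<bar> / 2) \<le> s x * y" for y
      proof -
        have "\<bar>s x * y\<bar> \<le> \<bar>y\<bar> / 2"
          using mult_right_mono[OF s_le[of x] abs_ge_zero[of y]] by (simp add: abs_mult)
        then show ?thesis by (simp add: abs_le_iff minus_le_iff)
      qed
      have "s x * W x = \<bar>W x\<bar> / 2" by (simp add: s_def sgn_if)
      then have "s x * infodiff K x = \<bar>W x\<bar> / 2 + s x * (infodiff I x - W x) + s x * infodiff R x"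
        by (simp add: split algebra_simps)
      moreover have "- (C * U x / 2) \<le> s x * (infodiff I x - W x)"
        by (rule order_trans[OF _ half]) (use elim in simp)
      ultimately have "\<bar>W x\<bar> / 2 + - (C * U x / 2) + - (\<bar>infodiff R x\<bar> / 2) \<le> s x * infodiff K x"
        using half[of "infodiff R x"] by (simp only:)
      moreover have "\<bar>infodiff K x\<bar> \<le> \<bar>W x\<bar> + C * U x + \<bar>infodiff R x\<bar>"
        unfolding split using elim by linarith
      ultimately show ?case by (simp add: mult.assoc)
    qed
  qed (use int_sD int_U in auto)
  moreover have "expectation (\<lambda>x. 2 * (s x * infodiff K x) + 2 * C * U x + 2 * \<bar>infodiff R x\<bar>)
      = 2 * expectation (\<lambda>x. s x * infodiff K x) + 2 * C * expectation U + 2 * expectation (\<lambda>x. \<bar>infodiff R x\<bar>)"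
    using int_sD int_U by simp
  \<comment> \<open>The constant 10 is \<open>2 * 4 + 2\<close>.\<close>
  ultimately have "expectation (\<lambda>x. \<bar>infodiff K x\<bar>)
      \<le> 10 * C * expectation U + 2 * expectation (\<lambda>x. \<bar>infodiff R x\<bar>)"
    by (simp add: mult.assoc)
  then show ?thesis
    using infodiff_first_moment[OF fin(2)] by (simp add: EU mult.assoc)
qed

section \<open>Comparison of the two variances\<close>

text \<open>Cutting \<bar>D\<bar> at \<open>k\<close> times the square root of \<open>card B\<close>
  bounds the second moment by the first below the cut and by the fourth above it. The parameters
  \<open>k\<close> and \<open>t\<close> stay free for the limits in \<open>var_eq\<close>.\<close>

lemma var_diff_le:
  assumes B: "finite B" "B \<noteq> {}" and k: "0 < k" and t: "0 < t"
  shows "\<bar>var_p - var_q\<bar> \<le>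
    (k * (expectation (\<lambda>x. \<bar>infodiff B x\<bar>) / sqrt (real (card B))) + 48 * C^4 / k^2) / (2 * t)
    + t * (var_p + var_q)"
proof -
  let ?N = "real (card B)" and ?D = "infodiff B"
  have N: "0 < ?N" using B by (simp add: card_gt_0_iff)
  define \<kappa> where "\<kappa> = k * sqrt ?N"
  have \<kappa>: "0 < \<kappa>" and \<kappa>2: "\<kappa>^2 = k^2 * ?N"
    using k N by (auto simp: \<kappa>_def power_mult_distrib)
  have "expectation (\<lambda>x. ?D x ^ 2) \<le> expectation (\<lambda>x. \<kappa> * \<bar>?D x\<bar> + ?D x ^ 4 / \<kappa>^2)"
  proof (rule integral_mono)
    fix x
    show "?D x ^ 2 \<le> \<kappa> * \<bar>?D x\<bar> + ?D x ^ 4 / \<kappa>^2"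
    proof (cases "\<bar>?D x\<bar> \<le> \<kappa>")
      case True
      then have "\<bar>?D x\<bar> * \<bar>?D x\<bar> \<le> \<kappa> * \<bar>?D x\<bar>" by (intro mult_right_mono) auto
      then have "?D x ^ 2 \<le> \<kappa> * \<bar>?D x\<bar>" by (simp add: power2_eq_square)
      moreover have "0 \<le> ?D x ^ 4 / \<kappa>^2" by simp
      ultimately show ?thesis by linarith
    next
      case False
      then have "\<kappa>^2 \<le> \<bar>?D x\<bar>^2" using \<kappa> by (intro power_mono) auto
      then have "?D x ^ 2 * \<kappa>^2 \<le> ?D x ^ 2 * ?D x ^ 2" by (intro mult_left_mono) auto
      also have "\<dots> = ?D x ^ 4" by (simp flip: power_add)
      finally have "?D x ^ 2 \<le> ?D x ^ 4 / \<kappa>^2" using \<kappa> by (simp add: field_simps)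
      moreover have "0 \<le> \<kappa> * \<bar>?D x\<bar>" using \<kappa> by simp
      ultimately show ?thesis by linarith
    qed
  qed auto
  also have "\<dots> = \<kappa> * expectation (\<lambda>x. \<bar>?D x\<bar>) + expectation (\<lambda>x. ?D x ^ 4) / \<kappa>^2"
    by simp
  also have "\<dots> \<le> \<kappa> * expectation (\<lambda>x. \<bar>?D x\<bar>) + 48 * C^4 * ?N^2 / \<kappa>^2"
    using infodiff_fourth_moment[OF B(1)] by (intro add_left_mono divide_right_mono) auto
  also have "\<dots> = ?N * (k * (expectation (\<lambda>x. \<bar>?D x\<bar>) / sqrt ?N) + 48 * C^4 / k^2)"
  proof -
    have "\<kappa> = ?N * (k / sqrt ?N)"
      using N by (simp add: \<kappa>_def field_simps)
    moreover have "48 * C^4 * ?N^2 / \<kappa>^2 = ?N * (48 * C^4 / k^2)"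
      unfolding \<kappa>2 using N k by (simp add: field_simps power2_eq_square)
    ultimately show ?thesis by (simp add: algebra_simps)
  qed
  finally have D2: "expectation (\<lambda>x. ?D x ^ 2)
      \<le> ?N * (k * (expectation (\<lambda>x. \<bar>?D x\<bar>) / sqrt ?N) + 48 * C^4 / k^2)" .
  have "?N * \<bar>var_p - var_q\<bar> = \<bar>expectation (\<lambda>x. infosum B x ^ 2 - infosum' B x ^ 2)\<bar>"
    using N infosum_moments(2)[OF B(1)] infosum'_moments(2)[OF B(1)]
    by (simp add: abs_mult right_diff_distrib[symmetric])
  also have "\<dots> \<le> expectation (\<lambda>x. \<bar>infosum B x ^ 2 - infosum' B x ^ 2\<bar>)"
    by (rule integral_abs_bound)
  also have "\<dots> \<le> expectation (\<lambda>x. ?D x ^ 2 / (2 * t) + t * (infosum B x ^ 2 + infosum' B x ^ 2))"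
  proof (rule integral_mono)
    fix x
    let ?a = "infosum B x" and ?b = "infosum' B x"
    \<comment> \<open>A weighted arithmetic-geometric mean inequality with weight \<open>t\<close>
      separates the small factor \<open>?D x\<close> from \<open>?a + ?b\<close>, which is only of
      normal fluctuation size.\<close>
    have "?a^2 - ?b^2 = - (?D x * (?a + ?b))"
      by (simp add: infodiff_eq power2_eq_square algebra_simps)
    then have "\<bar>?a^2 - ?b^2\<bar> = \<bar>?D x\<bar> * \<bar>?a + ?b\<bar>"
      by (simp add: abs_mult)
    also have "\<dots> \<le> ?D x ^ 2 / (2 * t) + t * \<bar>?a + ?b\<bar>^2 / 2"
    proof -
      have "0 \<le> (\<bar>?D x\<bar> - t * \<bar>?a + ?b\<bar>)^2 / (2 * t)" using t by simp
      also have "\<dots> = ?D x ^ 2 / (2 * t) + t * \<bar>?a + ?b\<bar>^2 / 2 - \<bar>?D x\<bar> * \<bar>?a + ?b\<bar>"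
        using t by (simp add: power2_diff power_mult_distrib field_simps) (simp add: power2_eq_square)
      finally show ?thesis by linarith
    qed
    also have "\<dots> \<le> ?D x ^ 2 / (2 * t) + t * (?a^2 + ?b^2)"
    proof -
      have "\<bar>?a + ?b\<bar>^2 / 2 \<le> ?a^2 + ?b^2"
        using zero_le_power2[of "?a - ?b"] by (simp add: power2_eq_square algebra_simps)
      from mult_left_mono[OF this less_imp_le[OF t]] show ?thesis by simp
    qed
    finally show "\<bar>?a^2 - ?b^2\<bar> \<le> ?D x ^ 2 / (2 * t) + t * (?a^2 + ?b^2)" .
  qed auto
  also have "\<dots> = expectation (\<lambda>x. ?D x ^ 2) / (2 * t) + t * (?N * var_p + ?N * var_q)"
    using infosum_moments(2)[OF B(1)] infosum'_moments(2)[OF B(1)] by simp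
  also have "\<dots> \<le> ?N * (k * (expectation (\<lambda>x. \<bar>?D x\<bar>) / sqrt ?N) + 48 * C^4 / k^2) / (2 * t)
      + t * (?N * var_p + ?N * var_q)"
    using D2 t by (intro add_right_mono divide_right_mono) auto
  also have "\<dots> = ?N * ((k * (expectation (\<lambda>x. \<bar>?D x\<bar>) / sqrt ?N) + 48 * C^4 / k^2) / (2 * t)
      + t * (var_p + var_q))"
    by (simp add: algebra_simps)
  finally show ?thesis
    using N by (simp only: mult_le_cancel_left_pos)
qed

text \<open>With side \<open>(m + 4) * n\<close>, removing \<open>2 * n\<close> on each side leaves
  a core of side \<open>m * n\<close>. After division by the square root of the volume, the frame
  term depends on \<open>m\<close> only, and the other term is scaled for the moment
  hypothesis.\<close>

lemma cube_first_moment_scaled: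
  fixes n m :: nat
  assumes n: "0 < n"
  defines "B \<equiv> cube 0 (int ((m + 4) * n)) :: (int^'d) set"
  shows "expectation (\<lambda>x. \<bar>infodiff B x\<bar>) / sqrt (real (card B))
    \<le> 10 * C * real (m + 4) powr (real CARD('d) / 2) * (real n powr (real CARD('d) / 2) * expectation (undet n))
      + 2 * sqrt (2 * (var_p + var_q) * (1 - (real m / real (m + 4)) ^ CARD('d)))"
proof -
  let ?d = "CARD('d)"
  define I where "I = (cube (2 * int n) (int ((m + 4) * n) - 2 * int n) :: (int^'d) set)"
  let ?N = "real (card B)"
  have cardB: "?N = (real (m + 4) * real n) ^ ?d"
    by (simp add: B_def finite_card_cube(2) nat_mult_distrib nat_add_distrib algebra_simps)
  have N: "0 < ?N" unfolding cardB using n by simp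
  have cardI: "real (card I) = (real m * real n) ^ ?d"
  proof -
    have "int ((m + 4) * n) - 2 * int n - 2 * int n = int (m * n)" by (simp add: algebra_simps)
    then show ?thesis by (simp only: I_def finite_card_cube(2)) simp
  qed
  have "I \<subseteq> B" unfolding I_def B_def cube_def by (auto; smt (verit) of_nat_0_le_iff)
  then have "real (card (B - I)) = ?N - real (card I)"
    by (simp add: card_Diff_subset B_def I_def finite_card_cube(1) card_mono of_nat_diff)
  also have "\<dots> = ?N * (1 - (real m / real (m + 4)) ^ ?d)"
    unfolding cardB cardI power_mult_distrib power_divide by (simp add: right_diff_distrib)
  finally have R: "real (card (B - I)) = ?N * (1 - (real m / real (m + 4)) ^ ?d)" .
  have sqrtN: "sqrt ?N = real (m + 4) powr (real ?d / 2) * real n powr (real ?d / 2)"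
  proof -
    have "sqrt ?N = ((real (m + 4) * real n) powr real ?d) powr (1/2)"
      unfolding cardB using n by (simp add: powr_half_sqrt powr_realpow)
    also have "\<dots> = (real (m + 4) * real n) powr (real ?d / 2)"
      by (simp add: powr_powr)
    also have "\<dots> = real (m + 4) powr (real ?d / 2) * real n powr (real ?d / 2)"
      by (rule powr_mult)
    finally show ?thesis .
  qed
  have "0 < int ((m + 4) * n)" using n by simp
  from infodiff_cube_first_moment[OF this, of n]
  have "expectation (\<lambda>x. \<bar>infodiff B x\<bar>) / sqrt ?N \<le>
     (10 * C * ?N * expectation (undet n) + 2 * sqrt (2 * (var_p + var_q) * real (card (B - I)))) / sqrt ?N"
    unfolding B_def[symmetric] I_def[symmetric] by (rule divide_right_mono) simp
  also have "\<dots> = 10 * C * sqrt ?N * expectation (undet n)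
      + 2 * sqrt (2 * (var_p + var_q) * (1 - (real m / real (m + 4)) ^ ?d))"
  proof -
    have 1: "?N / sqrt ?N = sqrt ?N" using N by (simp add: real_div_sqrt)
    have 2: "sqrt (2 * (var_p + var_q) * real (card (B - I)))
        = sqrt ?N * sqrt (2 * (var_p + var_q) * (1 - (real m / real (m + 4)) ^ ?d))"
      unfolding R by (simp add: real_sqrt_mult[symmetric] mult_ac)
    have "10 * C * ?N * expectation (undet n) / sqrt ?N = 10 * C * (?N / sqrt ?N) * expectation (undet n)"
      by simp
    then show ?thesis
      unfolding add_divide_distrib 1 2 using N by simp
  qed
  finally show ?thesis unfolding sqrtN by (simp add: mult_ac)
qed

text \<open>The limits are taken in turn: \<open>n\<close> to infinity removes the undetermined
  sites, \<open>m\<close> to infinity the frame, \<open>k\<close> to infinity the fourth-moment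
  term, and finally \<open>t\<close> tends to 0. The order matters: the factor
  \<open>(m + 4) powr (CARD('d) / 2)\<close> is harmless only for fixed \<open>m\<close>.\<close>

lemma var_eq:
  assumes lim: "(\<lambda>n. real n powr (real CARD('d) / 2) * expectation (undet n)) \<longlonglongrightarrow> 0"
  shows "var_p = var_q"
proof -
  let ?d = "CARD('d)" and ?s = "var_p + var_q"
  let ?r = "\<lambda>m. 2 * sqrt (2 * ?s * (1 - (real m / real (m + 4)) ^ ?d))"
  have s1: "\<bar>var_p - var_q\<bar> \<le> (k * ?r m + 48 * C^4 / k^2) / (2 * t) + t * ?s"
    if k: "0 < k" and t: "0 < t" for k t and m :: nat
  proof (rule LIMSEQ_le_const)
    let ?e = "\<lambda>n. 10 * C * real (m + 4) powr (real ?d / 2) * (real n powr (real ?d / 2) * expectation (undet n))"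
    have "(\<lambda>n. (k * (?e n + ?r m) + 48 * C^4 / k^2) / (2 * t) + t * ?s)
        \<longlonglongrightarrow> (k * (10 * C * real (m + 4) powr (real ?d / 2) * 0 + ?r m) + 48 * C^4 / k^2) / (2 * t) + t * ?s"
      using t by (intro tendsto_intros lim) auto
    then show "(\<lambda>n. (k * (?e n + ?r m) + 48 * C^4 / k^2) / (2 * t) + t * ?s)
        \<longlonglongrightarrow> (k * ?r m + 48 * C^4 / k^2) / (2 * t) + t * ?s"
      by simp
    have "\<bar>var_p - var_q\<bar> \<le> (k * (?e n + ?r m) + 48 * C^4 / k^2) / (2 * t) + t * ?s" if n: "n \<ge> 1" for n
    proof -
      let ?B = "cube 0 (int ((m + 4) * n)) :: (int^'d) set"
      have "0 \<in> ?B" using n by (simp add: cube_def)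
      then have "\<bar>var_p - var_q\<bar> \<le> (k * (expectation (\<lambda>x. \<bar>infodiff ?B x\<bar>) / sqrt (real (card ?B)))
          + 48 * C^4 / k^2) / (2 * t) + t * ?s"
        using k t by (intro var_diff_le finite_card_cube) auto
      also have "\<dots> \<le> (k * (?e n + ?r m) + 48 * C^4 / k^2) / (2 * t) + t * ?s"
        using cube_first_moment_scaled[of n m] n k t
        by (intro add_right_mono divide_right_mono mult_left_mono) auto
      finally show ?thesis .
    qed
    then show "\<exists>N. \<forall>n\<ge>N. \<bar>var_p - var_q\<bar> \<le> (k * (?e n + ?r m) + 48 * C^4 / k^2) / (2 * t) + t * ?s"
      by blast
  qed
  have s2: "\<bar>var_p - var_q\<bar> \<le> (48 * C^4 / k^2) / (2 * t) + t * ?s"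
    if k: "0 < k" and t: "0 < t" for k t
  proof (rule LIMSEQ_le_const)
    have "(\<lambda>m. 1 - 4 / real (m + 4)) \<longlonglongrightarrow> 1 - 0"
      by (intro tendsto_diff tendsto_const LIMSEQ_ignore_initial_segment lim_const_over_n)
    moreover have "1 - 4 / real (m + 4) = real m / real (m + 4)" for m :: nat
      by (simp add: field_simps)
    ultimately have "(\<lambda>m. real m / real (m + 4)) \<longlonglongrightarrow> 1" by simp
    then have "(\<lambda>m. (k * ?r m + 48 * C^4 / k^2) / (2 * t) + t * ?s)
        \<longlonglongrightarrow> (k * (2 * sqrt (2 * ?s * (1 - 1 ^ ?d))) + 48 * C^4 / k^2) / (2 * t) + t * ?s"
      using t by (intro tendsto_intros) auto
    then show "(\<lambda>m. (k * ?r m + 48 * C^4 / k^2) / (2 * t) + t * ?s) \<longlonglongrightarrow> (48 * C^4 / k^2) / (2 * t) + t * ?s"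
      by simp
  qed (use s1[OF k t] in blast)
  have s3: "\<bar>var_p - var_q\<bar> \<le> t * ?s" if t: "0 < t" for t
  proof (rule LIMSEQ_le_const)
    have "(\<lambda>k. (48 * C^4 * (1 / real k)^2) / (2 * t) + t * ?s) \<longlonglongrightarrow> (48 * C^4 * 0^2) / (2 * t) + t * ?s"
      using t by (intro tendsto_intros lim_const_over_n) auto
    then show "(\<lambda>k. (48 * C^4 / (real k)^2) / (2 * t) + t * ?s) \<longlonglongrightarrow> t * ?s"
      by (simp add: power_divide)
    show "\<exists>N. \<forall>k\<ge>N. \<bar>var_p - var_q\<bar> \<le> (48 * C^4 / (real k)^2) / (2 * t) + t * ?s"
      using s2[OF _ t] by (intro exI[of _ 1]) auto
  qed
  have "\<bar>var_p - var_q\<bar> \<le> 0"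
  proof (rule LIMSEQ_le_const)
    have "(\<lambda>k. inverse (real (Suc k)) * ?s) \<longlonglongrightarrow> 0 * ?s"
      by (intro tendsto_mult tendsto_const LIMSEQ_inverse_real_of_nat)
    then show "(\<lambda>k. inverse (real (Suc k)) * ?s) \<longlonglongrightarrow> 0" by simp
    show "\<exists>N. \<forall>k\<ge>N. \<bar>var_p - var_q\<bar> \<le> inverse (real (Suc k)) * ?s"
      by (intro exI allI impI s3) simp
  qed
  then show ?thesis by simp
qed

section \<open>From the moment of the coding radius to the decay of undetermined sites\<close>

lemma determined_if_coding_radius_le:
  assumes "coding_radius \<mu> \<phi> x \<le> enat n"
  shows "determined n x"
proof -
  let ?P = "\<lambda>n. AE a in \<mu>. (\<forall>i\<in>box n. a i = x i) \<longrightarrow> \<phi> a 0 = \<phi> x 0"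
  have ex: "\<exists>n. ?P n"
    using assms by (auto simp: coding_radius_def Let_def split: if_splits)
  then have le: "(LEAST n. ?P n) \<le> n"
    using assms by (simp add: coding_radius_def Let_def)
  have "?P (LEAST n. ?P n)" using LeastI_ex[OF ex] .
  moreover have "(box (LEAST n. ?P n) :: (int^'d) set) \<subseteq> box n"
    using le by (auto simp: box_def intro: order_trans)
  ultimately have "?P n" by (auto elim!: eventually_mono)
  then show ?thesis by (auto simp: determined_def codes_def)
qed

text \<open>Being undetermined at range \<open>n\<close> forces the coding radius to exceed
  \<open>n\<close>, so \<open>n powr \<alpha> * undet n\<close> is dominated by the integrable power
  of the radius and is eventually 0 at almost every point. Dominated convergence gives a limit 0,
  where Markov's inequality would give only boundedness.\<close>

lemma undet_decay:
  assumes "finitary \<mu> \<phi>"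
    and int: "integrable \<mu> (\<lambda>x. real (the_enat (coding_radius \<mu> \<phi> x)) powr \<alpha>)" and "0 \<le> \<alpha>"
  shows "(\<lambda>n. real n powr \<alpha> * expectation (undet n)) \<longlonglongrightarrow> 0"
proof -
  let ?R = "\<lambda>x. the_enat (coding_radius \<mu> \<phi> x)"
  \<comment> \<open>Finitariness confines the unspecified value of \<open>the_enat\<close> at
    infinity to a null set.\<close>
  have fin: "AE x in \<mu>. coding_radius \<mu> \<phi> x = enat (?R x)"
    using assms(1) unfolding finitary_def by eventually_elim auto
  have "(\<lambda>n. expectation (\<lambda>x. real n powr \<alpha> * undet n x)) \<longlonglongrightarrow> expectation (\<lambda>x. 0)"
  proof (rule integral_dominated_convergence[OF _ _ int])
    show "(\<lambda>x. real n powr \<alpha> * undet n x) \<in> borel_measurable \<mu>" for n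
      using measurable_depends_on[OF finite_box depends_on_undet, of n p] by measurable
    show "AE x in \<mu>. (\<lambda>n. real n powr \<alpha> * undet n x) \<longlonglongrightarrow> 0"
      using fin
    proof eventually_elim
      case (elim x)
      have "undet n x = 0" if "n \<ge> ?R x" for n
        using determined_if_coding_radius_le[of x n] elim that by (simp add: undet_def) (metis enat_ord_simps(1))
      then have "\<forall>\<^sub>F n in sequentially. real n powr \<alpha> * undet n x = 0"
        by (auto simp: eventually_sequentially)
      then show ?case by (rule tendsto_eventually)
    qed
    show "AE x in \<mu>. norm (real n powr \<alpha> * undet n x) \<le> real (?R x) powr \<alpha>" for n
      using fin
    proof eventually_elim
      case (elim x)
      show ?case
      proof (cases "determined n x")
        case False
        then have "\<not> coding_radius \<mu> \<phi> x \<le> enat n" using determined_if_coding_radius_le by blast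
        then have "n \<le> ?R x" using elim by (metis enat_ord_simps(1) linear)
        then show ?thesis using False assms(3) by (simp add: undet_def powr_mono2)
      qed (simp add: undet_def)
    qed
  qed simp
  then show ?thesis by simp
qed

end

theorem theorem1:
  fixes p :: "'a::finite pmf" and q :: "'b::finite pmf"
    and \<phi> :: "(int^'d \<Rightarrow> 'a) \<Rightarrow> (int^'d \<Rightarrow> 'b)"
  assumes "entropy_pv p = entropy_pv q"
    and "is_homomorphism (iid_measure p) (iid_measure q) \<phi>"
    and "finitary (iid_measure p) \<phi>"
    and "integrable (iid_measure p)
           (\<lambda>x. real (the_enat (coding_radius (iid_measure p) \<phi> x)) powr (real CARD('d) / 2))"
  shows "prob_space.variance (iid_measure p :: (int^'d \<Rightarrow> 'a) measure) (\<lambda>x. info_fun p (x 0))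
       = prob_space.variance (iid_measure q :: (int^'d \<Rightarrow> 'b) measure) (\<lambda>y. info_fun q (y 0))"
proof -
  obtain Cp Cq where Cp: "\<And>a. info_fun p a \<le> Cp" and Cq: "\<And>b. info_fun q b \<le> Cq"
    using info_fun_bounded[of p] info_fun_bounded[of q] by metis
  interpret iid_homomorphism p q \<phi> "max Cp Cq"
    using assms(1,2) Cp Cq by unfold_locales (auto simp: le_max_iff_disj)
  have "var_p = var_q"
    by (rule var_eq[OF undet_decay[OF assms(3,4)]]) simp
  then show ?thesis
    by (simp add: variance_info var_p_def var_q_def)
qed

end
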